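(* Consider the exponential Runge–Kutta method with time step $\tau=T/N$ ($N$ a positive integer), with Runge–Kutta coefficients $a_{ij},b_i$ ($i,j=1,\dots,s$) and $c_i=\sum_{j=1}^s a_{ij}$, which computes $(\psi^{n+1},q^{n+1})$ from $(\psi^n,q^n)$, $n=0,\dots,N-1$, through the stages $$\Psi_i=\exp(-\mathrm{i}\mathcal{L}c_i\tau)\psi^n+\tau\sum_{j=1}^{s}a_{ij}\exp(\mathrm{i}\mathcal{L}(c_j-c_i)\tau)k_j,\qquad Q_i=q^n+\tau\sum_{j=1}^{s}a_{ij}l_j,\qquad i=1,\dots,s,$$ where $$k_i=-\mathrm{i}\,\frac{\beta|\Psi_i|^2\Psi_i Q_i}{\sqrt{(\Psi_i^2,\Psi_i^2)+C_0}},\qquad l_i=2\,\mathrm{Re}\Big(-\mathrm{i}\mathcal{L}\Psi_i,\ \frac{|\Psi_i|^2\Psi_i}{\sqrt{(\Psi_i^2,\Psi_i^2)+C_0}}\Big),$$ and the updates $$\psi^{n+1}=\exp(-\mathrm{i}\mathcal{L}\tau)\psi^n+\tau\sum_{i=1}^{s}b_i\exp(-\mathrm{i}\mathcal{L}(1-c_i)\tau)k_i,\qquad q^{n+1}=q^n+\tau\sum_{i=1}^{s}b_i l_i.$$ If the coefficients of the Runge–Kutta method satisfy $$b_i a_{ij}+b_j a_{ji}=b_i b_j,\qquad \forall\, i,j=1,\dots,s,$$ then this method preserves the semi-discrete mass and modified energy conservation laws, that is, $$M^n=M^0,\qquad E^n=E^0,\qquad n=1,\dots,N,$$ where $$M^n=(\psi^n,\psi^n),\qquad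 E^n=(\mathcal{L}\psi^n,\psi^n)+\frac{\beta}{2}(q^n)^2-\frac{\beta}{2}C_0 .$$
   Context: $\Omega=[0,l_1]\times[0,l_2]$, and functions on $\Omega$ are complex-valued and $(l_1,l_2)$-periodic. The $L^2$ inner product is $(f,g)=\int_\Omega f\,\bar g\,dx\,dy$, where $\bar g$ is the complex conjugate of $g$ (so $(f^2,f^2)=\int_\Omega|f|^4\,dx\,dy$), and $\mathrm{i}=\sqrt{-1}$. $\beta$ is a given real constant, $C_0>0$ is a constant, and $[0,T]$ is the time interval. The operator $\mathcal{L}$ is $\mathcal{L}\psi=-\frac12\Delta\psi$ with periodic boundary conditions, and $\exp(\mathrm{i}\mathcal{L}t)$ denotes the corresponding operator exponential. The method discretizes in time only (hence "semi-discrete") the scalar-auxiliary-variable system $$\partial_t\psi=-\mathrm{i}\Big(\mathcal{L}\psi+\frac{\beta|\psi|^2\psi\,q}{\sqrt{(\psi^2,\psi^2)+C_0}}\Big),\qquad \frac{d}{dt}q=2\,\mathrm{Re}\Big(\partial_t\psi,\ \frac{|\psi|^2\psi}{\sqrt{(\psi^2,\psi^2)+C_0}}\Big),$$ with initial conditions $\psi(\cdot,0)=\psi_0$ and $q(0)=\sqrt{(\psi_0^2,\psi_0^2)+C_0}$, where $\psi_0$ is a given $(l_1,l_2)$-periodic complex-valued function. This system is a reformulation of the cubic nonlinear Schrödinger equation $\mathrm{i}\partial_t\psi=-\frac12\Delta\psi+\beta|\psi|^2\psi$ with auxiliary variable $q(t)=\sqrt{(\psi^2,\psi^2)+C_0}$.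 Here $\psi^n$ and $q^n$ approximate $\psi(\cdot,t_n)$ and $q(t_n)$ at $t_n=n\tau$, with $\psi^0=\psi_0$ and $q^0=q(0)$; $\Psi_i$ and $Q_i$ approximate $\psi$ and $q$ at $t_n+c_i\tau$. *)

theory Defs
  imports "HOL-Analysis.Analysis"
begin

subsection \<open>Periodic functions, the inner product and \<open>\<L>\<close>\<close>

type_synonym wave = "real \<times> real \<Rightarrow> complex"

definition Omega :: "real \<Rightarrow> real \<Rightarrow> (real \<times> real) set" where
  "Omega l1 l2 = {0..l1} \<times> {0..l2}"

definition periodic2 :: "real \<Rightarrow> real \<Rightarrow> wave \<Rightarrow> bool" where
  "periodic2 l1 l2 f \<longleftrightarrow> (\<forall>x y. f (x + l1, y) = f (x, y) \<and> f (x, y + l2) = f (x, y))"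

definition dx :: "wave \<Rightarrow> wave" where
  "dx f = (\<lambda>z. frechet_derivative f (at z) (1, 0))"

definition dy :: "wave \<Rightarrow> wave" where
  "dy f = (\<lambda>z. frechet_derivative f (at z) (0, 1))"

definition C1 :: "wave \<Rightarrow> bool" where
  "C1 f \<longleftrightarrow> (\<forall>z. f differentiable (at z)) \<and> continuous_on UNIV (dx f) \<and> continuous_on UNIV (dy f)"

text \<open>The functions to which \<open>\<L>\<close> is applied are periodic and twice continuously differentiable
  on the whole plane, so that the classical Laplacian makes sense and is continuous.\<close>

definition C2per :: "real \<Rightarrow> real \<Rightarrow> wave set" where
  "C2per l1 l2 = {f. periodic2 l1 l2 f \<and> C1 f \<and> C1 (dx f) \<and> C1 (dy f)}"

definition laplacian :: "wave \<Rightarrow> wave" where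
  "laplacian f = (\<lambda>z. dx (dx f) z + dy (dy f) z)"

definition opL :: "wave \<Rightarrow> wave" where
  "opL f = (\<lambda>z. - (1 / 2) * laplacian f z)"

definition ip :: "real \<Rightarrow> real \<Rightarrow> wave \<Rightarrow> wave \<Rightarrow> complex" where
  "ip l1 l2 f g = (LINT z:Omega l1 l2|lborel. f z * cnj (g z))"

subsection \<open>The operator exponential\<close>

text \<open>\<open>\<L>\<close> is unbounded, so its exponential is not a power series in \<open>\<L>\<close>; it is given by the spectral
  calculus.  The modes below are the (orthogonal, complete) eigenfunctions of \<open>\<L>\<close> under
  periodic boundary conditions, with eigenvalues \<open>eigval\<close> (lemma \<open>opL_mode\<close>), and
  \<open>exp (\<i> \<L> t)\<close> multiplies the coefficient of each mode by \<open>exp (\<i> \<lambda> t)\<close>.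
  For \<open>f \<in> C2per l1 l2\<close> the series converges absolutely at every point.\<close>

definition mode :: "real \<Rightarrow> real \<Rightarrow> int \<times> int \<Rightarrow> wave" where
  "mode l1 l2 k = (\<lambda>z. exp (\<i> * of_real (2 * pi * (of_int (fst k) * fst z / l1 + of_int (snd k) * snd z / l2))))"

definition eigval :: "real \<Rightarrow> real \<Rightarrow> int \<times> int \<Rightarrow> real" where
  "eigval l1 l2 k = 2 * pi\<^sup>2 * ((of_int (fst k) / l1)\<^sup>2 + (of_int (snd k) / l2)\<^sup>2)"

definition fcoeff :: "real \<Rightarrow> real \<Rightarrow> wave \<Rightarrow> int \<times> int \<Rightarrow> complex" where
  "fcoeff l1 l2 f k = ip l1 l2 f (mode l1 l2 k) / of_real (l1 * l2)"

definition exp_iL :: "real \<Rightarrow> real \<Rightarrow> real \<Rightarrow> wave \<Rightarrow> wave" where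
  "exp_iL l1 l2 t f =
     (\<lambda>z. \<Sum>\<^sub>\<infinity>k\<in>UNIV. exp (\<i> * of_real (eigval l1 l2 k * t)) * fcoeff l1 l2 f k * mode l1 l2 k z)"

lemma mode_has_derivative:
  "((\<lambda>z. c * mode l1 l2 k z) has_derivative
    (\<lambda>h. c * (\<i> * of_real (2 * pi * (of_int (fst k) * fst h / l1 + of_int (snd k) * snd h / l2))
            * mode l1 l2 k z))) (at z)"
proof -
  let ?g = "\<lambda>h::real \<times> real. \<i> * complex_of_real (2 * pi * (of_int (fst k) * fst h / l1 + of_int (snd k) * snd h / l2))"
  have "bounded_linear ?g"
    by (auto intro!: linear_conv_bounded_linear[THEN iffD1] linearI
        simp: algebra_simps add_divide_distrib scaleR_conv_of_real)
  then have "(?g has_derivative ?g) (at z)"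
    by (rule bounded_linear_imp_has_derivative)
  from has_derivative_compose[OF this DERIV_exp[unfolded has_field_derivative_def]]
  have "((\<lambda>z. exp (?g z)) has_derivative (\<lambda>h. exp (?g z) * ?g h)) (at z)" .
  from has_derivative_mult_right[OF this, of c] show ?thesis
    unfolding mode_def by (simp add: mult.commute)
qed

lemma mode_differentiable: "(\<lambda>z. c * mode l1 l2 k z) differentiable (at z)"
  using mode_has_derivative differentiableI by blast

lemma dx_mode: "dx (\<lambda>z. c * mode l1 l2 k z) =
    (\<lambda>z. (c * (\<i> * of_real (2 * pi * of_int (fst k) / l1))) * mode l1 l2 k z)"
  unfolding dx_def by (simp add: frechet_derivative_at[OF mode_has_derivative, symmetric] fun_eq_iff)

lemma dy_mode: "dy (\<lambda>z. c * mode l1 l2 k z) =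
    (\<lambda>z. (c * (\<i> * of_real (2 * pi * of_int (snd k) / l2))) * mode l1 l2 k z)"
  unfolding dy_def by (simp add: frechet_derivative_at[OF mode_has_derivative, symmetric] fun_eq_iff)

lemma opL_mode: "opL (mode l1 l2 k) = (\<lambda>z. of_real (eigval l1 l2 k) * mode l1 l2 k z)"
proof -
  have "mode l1 l2 k = (\<lambda>z. 1 * mode l1 l2 k z)" by simp
  then have "opL (mode l1 l2 k) = opL (\<lambda>z. 1 * mode l1 l2 k z)" by metis
  also have "\<dots> = (\<lambda>z. of_real (eigval l1 l2 k) * mode l1 l2 k z)"
    unfolding opL_def laplacian_def dx_mode dy_mode
    by (simp add: fun_eq_iff eigval_def power2_eq_square algebra_simps)
  finally show ?thesis .
qed

lemma mode_C2per:
  assumes "l1 > 0" "l2 > 0"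
  shows "mode l1 l2 k \<in> C2per l1 l2"
proof -
  have C1_mode: "C1 (\<lambda>z. c * mode l1 l2 k z)" for c
    unfolding C1_def dx_mode dy_mode
    by (intro conjI allI differentiable_imp_continuous_on differentiable_at_imp_differentiable_on
        mode_differentiable)
  have shift: "exp (\<i> * of_real (2 * pi * (u + of_int m))) = exp (\<i> * of_real (2 * pi * u))" for u :: real and m
  proof -
    have "\<i> * complex_of_real (2 * pi * (u + of_int m)) = \<i> * of_real (2 * pi * u) + (2 * of_int m * pi) * \<i>"
      by (simp add: algebra_simps)
    moreover have "exp (complex_of_real (2 * of_int m * pi) * \<i>) = 1"
      unfolding exp_eq_1 by (auto intro!: exI[of _ m])
    ultimately show ?thesis by (simp only: exp_add mult_1_right)
  qed
  have "periodic2 l1 l2 (mode l1 l2 k)"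
    unfolding periodic2_def mode_def
  proof (intro allI conjI)
    fix x y :: real
    show "exp (\<i> * of_real (2 * pi * (of_int (fst k) * fst (x + l1, y) / l1 + of_int (snd k) * snd (x + l1, y) / l2)))
        = exp (\<i> * of_real (2 * pi * (of_int (fst k) * fst (x, y) / l1 + of_int (snd k) * snd (x, y) / l2)))"
      using shift[of "of_int (fst k) * x / l1 + of_int (snd k) * y / l2" "fst k"] assms
      by (simp add: field_simps)
    show "exp (\<i> * of_real (2 * pi * (of_int (fst k) * fst (x, y + l2) / l1 + of_int (snd k) * snd (x, y + l2) / l2)))
        = exp (\<i> * of_real (2 * pi * (of_int (fst k) * fst (x, y) / l1 + of_int (snd k) * snd (x, y) / l2)))"
      using shift[of "of_int (fst k) * x / l1 + of_int (snd k) * y / l2" "snd k"] assms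
      by (simp add: field_simps)
  qed
  moreover have "C1 (mode l1 l2 k)" using C1_mode[of 1] by simp
  moreover have "C1 (dx (\<lambda>z. 1 * mode l1 l2 k z))" by (subst dx_mode) (rule C1_mode)
  moreover have "C1 (dy (\<lambda>z. 1 * mode l1 l2 k z))" by (subst dy_mode) (rule C1_mode)
  ultimately show ?thesis by (simp add: C2per_def)
qed

subsection \<open>The exponential Runge-Kutta scheme for the auxiliary-variable system\<close>

text \<open>The number \<open>(f\<^sup>2, f\<^sup>2)\<close> is real; \<open>Re\<close> only changes its type.\<close>

definition sav_root :: "real \<Rightarrow> real \<Rightarrow> real \<Rightarrow> wave \<Rightarrow> real" where
  "sav_root l1 l2 C0 f = sqrt (Re (ip l1 l2 (\<lambda>z. (f z)\<^sup>2) (\<lambda>z. (f z)\<^sup>2)) + C0)"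

definition slope_psi :: "real \<Rightarrow> real \<Rightarrow> real \<Rightarrow> real \<Rightarrow> wave \<Rightarrow> real \<Rightarrow> wave" where
  "slope_psi l1 l2 \<beta> C0 f q =
     (\<lambda>z. - \<i> * (of_real \<beta> * (of_real (cmod (f z)))\<^sup>2 * f z * of_real q / of_real (sav_root l1 l2 C0 f)))"

definition slope_q :: "real \<Rightarrow> real \<Rightarrow> real \<Rightarrow> wave \<Rightarrow> real" where
  "slope_q l1 l2 C0 f =
     2 * Re (ip l1 l2 (\<lambda>z. - \<i> * opL f z)
                      (\<lambda>z. (of_real (cmod (f z)))\<^sup>2 * f z / of_real (sav_root l1 l2 C0 f)))"

definition rk_node :: "nat \<Rightarrow> (nat \<Rightarrow> nat \<Rightarrow> real) \<Rightarrow> nat \<Rightarrow> real" where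
  "rk_node s a i = (\<Sum>j=1..s. a i j)"

text \<open>\<open>erk_step \<dots> \<psi> q \<Psi> Q \<psi>' q'\<close>: one step of size \<open>\<tau>\<close> leads from \<open>(\<psi>, q)\<close> to \<open>(\<psi>', q')\<close>, with
  \<open>(\<Psi> i, Q i)\<close>, \<open>1 \<le> i \<le> s\<close>, solving the (in general implicit) stage equations.\<close>

definition erk_step ::
  "real \<Rightarrow> real \<Rightarrow> real \<Rightarrow> real \<Rightarrow> nat \<Rightarrow> (nat \<Rightarrow> nat \<Rightarrow> real) \<Rightarrow> (nat \<Rightarrow> real) \<Rightarrow> real \<Rightarrow>
   wave \<Rightarrow> real \<Rightarrow> (nat \<Rightarrow> wave) \<Rightarrow> (nat \<Rightarrow> real) \<Rightarrow> wave \<Rightarrow> real \<Rightarrow> bool" where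
  "erk_step l1 l2 \<beta> C0 s a b \<tau> \<psi> q \<Psi> Q \<psi>' q' \<longleftrightarrow>
    (let c = rk_node s a;
         k = (\<lambda>i. slope_psi l1 l2 \<beta> C0 (\<Psi> i) (Q i));
         l = (\<lambda>i. slope_q l1 l2 C0 (\<Psi> i))
     in (\<forall>i\<in>{1..s}.
           \<Psi> i = (\<lambda>z. exp_iL l1 l2 (- (c i * \<tau>)) \<psi> z
                    + of_real \<tau> * (\<Sum>j=1..s. of_real (a i j) * exp_iL l1 l2 ((c j - c i) * \<tau>) (k j) z)) \<and>
           Q i = q + \<tau> * (\<Sum>j=1..s. a i j * l j)) \<and>
        \<psi>' = (\<lambda>z. exp_iL l1 l2 (- \<tau>) \<psi> z
                 + of_real \<tau> * (\<Sum>i=1..s. of_real (b i) * exp_iL l1 l2 (- ((1 - c i) * \<tau>)) (k i) z)) \<and>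
        q' = q + \<tau> * (\<Sum>i=1..s. b i * l i))"

definition mass :: "real \<Rightarrow> real \<Rightarrow> wave \<Rightarrow> complex" where
  "mass l1 l2 \<psi> = ip l1 l2 \<psi> \<psi>"

definition mod_energy :: "real \<Rightarrow> real \<Rightarrow> real \<Rightarrow> real \<Rightarrow> wave \<Rightarrow> real \<Rightarrow> complex" where
  "mod_energy l1 l2 \<beta> C0 \<psi> q =
     ip l1 l2 (opL \<psi>) \<psi> + of_real (\<beta> / 2 * q\<^sup>2) - of_real (\<beta> / 2 * C0)"

end

theory Submission
  imports Defs
begin

text \<open>In Fourier coefficients \<open>exp (\<i> \<L> t)\<close> is multiplication by a unimodular number, so after
  rotating the stages back to the start of the step the scheme is an ordinary Runge-Kutta method
  in every mode.  The condition on the coefficients makes every quadratic form change by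
  \<open>2 \<tau> \<Sum> b\<^sub>i \<langle>X\<^sub>i, k\<^sub>i\<rangle>\<close> over a step.  Parseval's identity sums this over the modes, with weight 1 for the
  mass and with the eigenvalues of \<open>\<L>\<close> for the energy.  For the mass, \<open>Re (\<Psi>\<^sub>i, k\<^sub>i) = 0\<close>; for the
  energy, \<open>Re (\<L> \<Psi>\<^sub>i, k\<^sub>i)\<close> cancels the contribution \<open>\<beta>/2 Q\<^sub>i l\<^sub>i\<close> of \<open>\<beta>/2 q\<^sup>2\<close>.\<close>

subsection \<open>Bounded measurable functions and the inner product\<close>

text \<open>Parseval's identity rests on pointwise convergence of the Fourier series of a C2
  function. That argument divides by factors vanishing along whole lines, so its quotients are
  bounded but may be discontinuous; hence the inner product and Bessel's inequality are developed
  for bounded Borel functions. A second obstacle is that \<open>exp_iL\<close> of a C2 function is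
  controlled only through an absolutely convergent series, so it is never differentiated: its
  coefficients carry the argument, and regularity is taken from the hypotheses on
  \<open>\<psi> n\<close> and \<open>\<Psi> n i\<close>. The nonlinear slopes inherit that
  regularity because |f|^2 f is a polynomial in f and its conjugate.\<close>

definition bdd_meas :: "wave \<Rightarrow> bool" where
  "bdd_meas f \<longleftrightarrow> f \<in> borel_measurable borel \<and> bounded (range f)"

lemma bdd_measI:
  assumes "f \<in> borel_measurable borel" "\<And>z. cmod (f z) \<le> B"
  shows "bdd_meas f"
  using assms by (auto simp: bdd_meas_def bounded_iff)

lemma bdd_measE:
  assumes "bdd_meas f"
  obtains B where "B \<ge> 0" "\<And>z. cmod (f z) \<le> B"
  using assms unfolding bdd_meas_def bounded_pos by (metis less_le rangeI)

lemma bdd_meas_measurable: "bdd_meas f \<Longrightarrow> f \<in> borel_measurable borel"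
  by (simp add: bdd_meas_def)

lemma bdd_meas_const: "bdd_meas (\<lambda>z. c)"
  by (rule bdd_measI[of _ "cmod c"]) auto

lemma bdd_meas_add:
  assumes "bdd_meas f" "bdd_meas g"
  shows "bdd_meas (\<lambda>z. f z + g z)"
proof -
  obtain A where "\<And>z. cmod (f z) \<le> A"
    using bdd_measE[OF assms(1)] by blast
  moreover obtain B where "\<And>z. cmod (g z) \<le> B"
    using bdd_measE[OF assms(2)] by blast
  ultimately have "cmod (f z + g z) \<le> A + B" for z
    by (rule norm_triangle_mono)
  then show ?thesis
    using assms[THEN bdd_meas_measurable] by (intro bdd_measI) measurable
qed

lemma bdd_meas_mult:
  assumes "bdd_meas f" "bdd_meas g"
  shows "bdd_meas (\<lambda>z. f z * g z)"
proof -
  obtain A where "A \<ge> 0" "\<And>z. cmod (f z) \<le> A"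
    using bdd_measE[OF assms(1)] by blast
  moreover obtain B where "\<And>z. cmod (g z) \<le> B"
    using bdd_measE[OF assms(2)] by blast
  ultimately have "cmod (f z * g z) \<le> A * B" for z
    by (simp add: norm_mult mult_mono)
  then show ?thesis
    using assms[THEN bdd_meas_measurable] by (intro bdd_measI) measurable
qed

lemma bdd_meas_cnj:
  assumes "bdd_meas f"
  shows "bdd_meas (\<lambda>z. cnj (f z))"
proof -
  have "(\<lambda>z. cnj (f z)) \<in> borel_measurable borel"
    using assms by (auto intro!: borel_measurable_continuous_on[where f = cnj] continuous_intros simp: bdd_meas_def)
  then show ?thesis
    using assms by (auto simp: bdd_meas_def bounded_iff)
qed

lemma bdd_meas_cmult: "bdd_meas f \<Longrightarrow> bdd_meas (\<lambda>z. c * f z)"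
  by (intro bdd_meas_mult bdd_meas_const)

lemma bdd_meas_diff: "bdd_meas f \<Longrightarrow> bdd_meas g \<Longrightarrow> bdd_meas (\<lambda>z. f z - g z)"
  using bdd_meas_add[of f "\<lambda>z. (-1) * g z"] bdd_meas_cmult[of g "-1"] by simp

lemma bdd_meas_sum:
  "(\<And>i. i \<in> I \<Longrightarrow> bdd_meas (f i)) \<Longrightarrow> bdd_meas (\<lambda>z. \<Sum>i\<in>I. f i z)"
  by (induction I rule: infinite_finite_induct) (auto intro: bdd_meas_add bdd_meas_const)

section \<open>The L2 inner product on the period rectangle\<close>

locale torus =
  fixes l1 l2 :: real
  assumes l1_pos: "l1 > 0" and l2_pos: "l2 > 0"
begin

abbreviation "V \<equiv> l1 * l2"
abbreviation "inner2 \<equiv> ip l1 l2"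
abbreviation "e \<equiv> mode l1 l2"
abbreviation "ev \<equiv> eigval l1 l2"
abbreviation "coef \<equiv> fcoeff l1 l2"

lemma V_pos: "V > 0"
  using l1_pos l2_pos by simp

lemma Omega_cbox: "Omega l1 l2 = cbox (0, 0) (l1, l2)"
  by (simp add: Omega_def cbox_Pair_eq)

lemma Omega_sets [measurable]: "Omega l1 l2 \<in> sets borel"
  by (simp add: Omega_cbox)

lemma content_Omega: "measure lborel (Omega l1 l2) = V"
  using l1_pos l2_pos unfolding Omega_cbox content_Pair by simp

lemma emeasure_Omega: "emeasure lborel (Omega l1 l2) < \<infinity>"
  unfolding Omega_cbox by (rule emeasure_lborel_cbox_finite)

lemma set_integrable_bdd_meas:
  assumes "bdd_meas f"
  shows "set_integrable lborel (Omega l1 l2) f"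
proof -
  obtain B where B: "B \<ge> 0" "\<And>z. cmod (f z) \<le> B"
    using bdd_measE[OF assms] by blast
  show ?thesis
    unfolding set_integrable_def
  proof (rule integrableI_bounded_set_indicator)
    show "f \<in> borel_measurable lborel"
      using bdd_meas_measurable[OF assms] by simp
    show "AE z in lborel. z \<in> Omega l1 l2 \<longrightarrow> cmod (f z) \<le> B"
      using B by simp
  qed (use emeasure_Omega in auto)
qed

lemma integrable_ip:
  assumes "bdd_meas f" "bdd_meas g"
  shows "set_integrable lborel (Omega l1 l2) (\<lambda>z. f z * cnj (g z))"
  by (intro set_integrable_bdd_meas bdd_meas_mult bdd_meas_cnj assms)

lemma ip_add_left:
  assumes "bdd_meas f" "bdd_meas g" "bdd_meas h"
  shows "inner2 (\<lambda>z. f z + g z) h = inner2 f h + inner2 g h"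
  unfolding ip_def distrib_right
  by (intro set_integral_add integrable_ip assms)

lemma ip_cmult_left: "inner2 (\<lambda>z. c * f z) g = c * inner2 f g"
  by (simp add: ip_def mult.assoc)

lemma ip_cnj: "inner2 g f = cnj (inner2 f g)"
  unfolding ip_def set_lebesgue_integral_def Bochner_Integration.integral_cnj[symmetric]
  by (intro Bochner_Integration.integral_cong) (auto simp: mult.commute)

lemma ip_cmult_right: "inner2 f (\<lambda>z. c * g z) = cnj c * inner2 f g"
  by (simp add: ip_cnj[of f] ip_cmult_left)

lemma ip_diff_left:
  assumes "bdd_meas f" "bdd_meas g" "bdd_meas h"
  shows "inner2 (\<lambda>z. f z - g z) h = inner2 f h - inner2 g h"
  unfolding ip_def left_diff_distrib
  by (intro set_integral_diff integrable_ip assms)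

lemma ip_diff_right:
  assumes "bdd_meas f" "bdd_meas g" "bdd_meas h"
  shows "inner2 h (\<lambda>z. f z - g z) = inner2 h f - inner2 h g"
  using ip_diff_left[OF assms] by (metis ip_cnj complex_cnj_diff)

lemma ip_sum_left:
  assumes "\<And>i. i \<in> I \<Longrightarrow> bdd_meas (f i)" "bdd_meas h"
  shows "inner2 (\<lambda>z. \<Sum>i\<in>I. f i z) h = (\<Sum>i\<in>I. inner2 (f i) h)"
  using assms
proof (induction I rule: infinite_finite_induct)
  case (insert i I)
  then show ?case
    by (simp add: ip_add_left bdd_meas_sum)
qed (auto simp: ip_def)

lemma ip_norm_le:
  assumes "bdd_meas f" "bdd_meas g" "\<And>z. cmod (f z) \<le> A" "\<And>z. cmod (g z) \<le> B"
  shows "cmod (inner2 f g) \<le> A * B * V"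
proof -
  have A: "A \<ge> 0"
    using assms(3) norm_ge_zero order_trans by blast
  have "cmod (inner2 f g) \<le> (LINT z:Omega l1 l2|lborel. cmod (f z * cnj (g z)))"
    unfolding ip_def by (rule set_integral_norm_bound) (rule integrable_ip assms)+
  also have "\<dots> \<le> (LINT z:Omega l1 l2|lborel. A * B)"
  proof (rule set_integral_mono)
    show "set_integrable lborel (Omega l1 l2) (\<lambda>z. cmod (f z * cnj (g z)))"
      by (rule set_integrable_norm) (rule integrable_ip assms)+
    show "set_integrable lborel (Omega l1 l2) (\<lambda>z. A * B)"
      unfolding set_integrable_def using emeasure_Omega
      by (intro integrableI_bounded_set_indicator[where B = "\<bar>A * B\<bar>"]) auto
    show "cmod (f z * cnj (g z)) \<le> A * B" for z
      using assms(3,4) A by (simp add: norm_mult mult_mono)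
  qed
  also have "\<dots> = A * B * V"
    using emeasure_Omega by (simp add: set_lebesgue_integral_def content_Omega)
  finally show ?thesis .
qed

lemma ip_self: "inner2 f f = of_real (LINT z:Omega l1 l2|lborel. (cmod (f z))\<^sup>2)"
  unfolding ip_def complex_norm_square[symmetric] set_lebesgue_integral_def integral_complex_of_real[symmetric]
  by (intro Bochner_Integration.integral_cong) (auto simp: indicator_def)

lemma ip_self_nonneg: "Re (inner2 f f) \<ge> 0"
  unfolding ip_self set_lebesgue_integral_def by simp

lemma ip_self_real: "inner2 f f = of_real (Re (inner2 f f))"
  by (simp add: ip_self)

section \<open>Modes as characters, and linearity of the Fourier coefficients\<close>

lemma cmod_mode [simp]: "cmod (e k z) = 1"
  unfolding mode_def by (metis norm_exp_i_times)

lemma mode_continuous: "continuous_on A (e k)"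
  unfolding mode_def using l1_pos l2_pos by (intro continuous_intros) auto

lemma bdd_meas_mode: "bdd_meas (e k)"
  by (rule bdd_measI[of _ 1], rule borel_measurable_continuous_onI, rule mode_continuous) simp

lemma mode_add: "e (k + m) z = e k z * e m z"
  unfolding mode_def exp_add[symmetric]
  by (rule arg_cong[where f = exp]) (simp add: algebra_simps add_divide_distrib)

lemma mode_0 [simp]: "e 0 z = 1"
  by (simp add: mode_def)

lemma mode_uminus: "e (- k) z = cnj (e k z)"
proof -
  have "2 * pi * (of_int (fst (- k)) * fst z / l1 + of_int (snd (- k)) * snd z / l2)
      = - (2 * pi * (of_int (fst k) * fst z / l1 + of_int (snd k) * snd z / l2))"
    by (simp add: algebra_simps)
  then show ?thesis
    by (simp only: mode_def exp_cnj complex_cnj_mult complex_cnj_i complex_cnj_complex_of_real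
        of_real_minus mult_minus_left mult_minus_right)
qed

lemma coef_add:
  "bdd_meas f \<Longrightarrow> bdd_meas g \<Longrightarrow> coef (\<lambda>z. f z + g z) k = coef f k + coef g k"
  by (simp add: fcoeff_def ip_add_left bdd_meas_mode add_divide_distrib)

lemma coef_diff:
  "bdd_meas f \<Longrightarrow> bdd_meas g \<Longrightarrow> coef (\<lambda>z. f z - g z) k = coef f k - coef g k"
  by (simp add: fcoeff_def ip_diff_left bdd_meas_mode diff_divide_distrib)

lemma coef_cmult: "coef (\<lambda>z. c * f z) k = c * coef f k"
  by (simp add: fcoeff_def ip_cmult_left)

lemma coef_sum:
  "(\<And>i. i \<in> I \<Longrightarrow> bdd_meas (f i)) \<Longrightarrow> coef (\<lambda>z. \<Sum>i\<in>I. f i z) k = (\<Sum>i\<in>I. coef (f i) k)"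
  by (simp add: fcoeff_def ip_sum_left bdd_meas_mode sum_divide_distrib)

text \<open>The modes are characters, so a factor \<open>e m\<close> translates the index. This
  later turns a factor \<open>E - 1\<close> into a difference of consecutive coefficients.\<close>

lemma coef_mode_mult: "coef (\<lambda>z. e m z * f z) k = coef f (k - m)"
proof -
  have "e m z * f z * cnj (e k z) = f z * cnj (e (k - m) z)" for z
    using mode_add[of k "- m" z] by (simp add: mode_uminus)
  then show ?thesis
    by (simp only: fcoeff_def ip_def)
qed

subsection \<open>Integration by parts\<close>

abbreviation "mu1 k \<equiv> \<i> * complex_of_real (2 * pi * of_int (fst k) / l1)"
abbreviation "mu2 k \<equiv> \<i> * complex_of_real (2 * pi * of_int (snd k) / l2)"

text \<open>Both orders of integration are kept, so that the variable being differentiated can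
  always be the inner one.\<close>

lemma LINT_Omega_continuous:
  fixes F :: "real \<times> real \<Rightarrow> complex"
  assumes "continuous_on UNIV F"
  shows "(LINT z:Omega l1 l2|lborel. F z) = integral {0..l1} (\<lambda>x. integral {0..l2} (\<lambda>y. F (x, y)))"
    and "(LINT z:Omega l1 l2|lborel. F z) = integral {0..l2} (\<lambda>y. integral {0..l1} (\<lambda>x. F (x, y)))"
proof -
  have c: "continuous_on A F" for A
    using assms by (rule continuous_on_subset) simp
  have "set_integrable lborel (Omega l1 l2) F"
    unfolding set_integrable_def Omega_cbox by (intro borel_integrable_compact c) simp
  then have "(LINT z:Omega l1 l2|lborel. F z) = integral (cbox (0, 0) (l1, l2)) F"
    unfolding Omega_cbox by (rule set_borel_integral_eq_integral)
  also have "\<dots> = integral (cbox 0 l1) (\<lambda>x. integral (cbox 0 l2) (\<lambda>y. F (x, y)))"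
    by (rule integral_prod_continuous) (rule c)
  finally show *: "(LINT z:Omega l1 l2|lborel. F z) = integral {0..l1} (\<lambda>x. integral {0..l2} (\<lambda>y. F (x, y)))"
    by simp
  have "integral (cbox 0 l1) (\<lambda>x. integral (cbox 0 l2) (\<lambda>y. F (x, y)))
      = integral (cbox 0 l2) (\<lambda>y. integral (cbox 0 l1) (\<lambda>x. F (x, y)))"
    by (rule integral_swap_continuous) (simp add: c)
  with * show "(LINT z:Omega l1 l2|lborel. F z) = integral {0..l2} (\<lambda>y. integral {0..l1} (\<lambda>x. F (x, y)))"
    by simp
qed

text \<open>The fundamental theorem of calculus in the inner variable leaves the values on opposite
  edges, which agree by periodicity.\<close>

lemma LINT_partial_x:
  assumes "continuous_on UNIV F'"
    and "\<And>x y. ((\<lambda>x. F (x, y)) has_vector_derivative F' (x, y)) (at x)"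
    and "periodic2 l1 l2 F"
  shows "(LINT z:Omega l1 l2|lborel. F' z) = 0"
proof -
  have "integral {0..l1} (\<lambda>x. F' (x, y)) = F (l1, y) - F (0, y)" for y
    using l1_pos assms(2)
    by (intro integral_unique fundamental_theorem_of_calculus) (auto intro: has_vector_derivative_at_within)
  moreover have "F (l1, y) = F (0, y)" for y
    using assms(3) by (metis periodic2_def add_0)
  ultimately show ?thesis
    by (simp add: LINT_Omega_continuous(2)[OF assms(1)])
qed

lemma LINT_partial_y:
  assumes "continuous_on UNIV F'"
    and "\<And>x y. ((\<lambda>y. F (x, y)) has_vector_derivative F' (x, y)) (at y)"
    and "periodic2 l1 l2 F"
  shows "(LINT z:Omega l1 l2|lborel. F' z) = 0"
proof -
  have "integral {0..l2} (\<lambda>y. F' (x, y)) = F (x, l2) - F (x, 0)" for x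
    using l2_pos assms(2)
    by (intro integral_unique fundamental_theorem_of_calculus) (auto intro: has_vector_derivative_at_within)
  moreover have "F (x, l2) = F (x, 0)" for x
    using assms(3) by (metis periodic2_def add_0)
  ultimately show ?thesis
    by (simp add: LINT_Omega_continuous(1)[OF assms(1)])
qed

text \<open>A lattice translation moves any point into the compact rectangle, so a bound there is a
  bound on the whole plane.\<close>

lemma continuous_periodic_bounded:
  assumes "continuous_on UNIV f" "periodic2 l1 l2 f"
  shows "bdd_meas f"
proof -
  have shift: "f (x + of_int m * l1, y) = f (x, y)" "f (x, y + of_int m * l2) = f (x, y)" for x y m
  proof -
    interpret px: periodic_fun_simple "\<lambda>x. f (x, y)" l1
      using assms(2) by unfold_locales (simp add: periodic2_def)
    interpret py: periodic_fun_simple "\<lambda>y. f (x, y)" l2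
      using assms(2) by unfold_locales (simp add: periodic2_def)
    show "f (x + of_int m * l1, y) = f (x, y)" "f (x, y + of_int m * l2) = f (x, y)"
      by (rule px.plus_of_int py.plus_of_int)+
  qed
  have "compact (f ` Omega l1 l2)"
    unfolding Omega_cbox using assms(1) continuous_on_subset
    by (intro compact_continuous_image) (auto intro: continuous_on_subset)
  then obtain B where B: "\<And>z. z \<in> Omega l1 l2 \<Longrightarrow> cmod (f z) \<le> B"
    using compact_imp_bounded[of "f ` Omega l1 l2"] by (auto simp: bounded_iff)
  have "cmod (f (x, y)) \<le> B" for x y
  proof -
    define m n where "m = \<lfloor>x / l1\<rfloor>" and "n = \<lfloor>y / l2\<rfloor>"
    have "of_int m \<le> x / l1" "x / l1 \<le> of_int m + 1" "of_int n \<le> y / l2" "y / l2 \<le> of_int n + 1"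
      unfolding m_def n_def by linarith+
    then have "(x + of_int (- m) * l1, y + of_int (- n) * l2) \<in> Omega l1 l2"
      using l1_pos l2_pos by (simp add: Omega_def field_simps)
    from B[OF this] show ?thesis
      by (metis shift)
  qed
  then show ?thesis
    using borel_measurable_continuous_onI[OF assms(1)] by (intro bdd_measI[of f B]) auto
qed

end

subsection \<open>Periodic functions of class C2\<close>

lemma has_vector_derivative_dx:
  assumes "f differentiable (at (x, y))"
  shows "((\<lambda>x. f (x, y)) has_vector_derivative dx f (x, y)) (at x)"
proof -
  let ?D = "frechet_derivative f (at (x, y))"
  have D: "(f has_derivative ?D) (at (x, y))"
    using assms by (simp add: frechet_derivative_works)
  have "((\<lambda>x. (x, y)) has_derivative (\<lambda>h. (h, 0))) (at x)"
    by (intro has_derivative_Pair has_derivative_ident has_derivative_const)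
  from has_derivative_compose[OF this D]
  have "((\<lambda>x. f (x, y)) has_derivative (\<lambda>h. ?D (h, 0))) (at x)" .
  moreover have "(\<lambda>h. ?D (h, 0)) = (\<lambda>h. h *\<^sub>R dx f (x, y))"
  proof
    show "?D (h, 0) = h *\<^sub>R dx f (x, y)" for h
      unfolding dx_def using linear_scale[OF has_derivative_linear[OF D], of h "(1, 0)"] by simp
  qed
  ultimately show ?thesis
    by (simp only: has_vector_derivative_def)
qed

lemma has_vector_derivative_dy:
  assumes "f differentiable (at (x, y))"
  shows "((\<lambda>y. f (x, y)) has_vector_derivative dy f (x, y)) (at y)"
proof -
  let ?D = "frechet_derivative f (at (x, y))"
  have D: "(f has_derivative ?D) (at (x, y))"
    using assms by (simp add: frechet_derivative_works)
  have "((\<lambda>y. (x, y)) has_derivative (\<lambda>h. (0, h))) (at y)"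
    by (intro has_derivative_Pair has_derivative_ident has_derivative_const)
  from has_derivative_compose[OF this D]
  have "((\<lambda>y. f (x, y)) has_derivative (\<lambda>h. ?D (0, h))) (at y)" .
  moreover have "(\<lambda>h. ?D (0, h)) = (\<lambda>h. h *\<^sub>R dy f (x, y))"
  proof
    show "?D (0, h) = h *\<^sub>R dy f (x, y)" for h
      unfolding dy_def using linear_scale[OF has_derivative_linear[OF D], of h "(0, 1)"] by simp
  qed
  ultimately show ?thesis
    by (simp only: has_vector_derivative_def)
qed

lemma frechet_derivative_shift:
  assumes "\<And>z. f differentiable (at z)" "\<And>z. f (z + c) = f z"
  shows "frechet_derivative f (at (z + c)) = frechet_derivative f (at z)"
proof -
  let ?D = "frechet_derivative f (at (z + c))"
  have D: "(f has_derivative ?D) (at (z + c))"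
    using assms(1) by (simp add: frechet_derivative_works)
  have "((\<lambda>z. z + c) has_derivative (\<lambda>h. h)) (at z)"
    by (auto intro!: derivative_eq_intros)
  from has_derivative_compose[OF this D]
  have "(f has_derivative ?D) (at z)"
    by (simp add: assms(2))
  then show ?thesis
    by (metis frechet_derivative_at)
qed

lemma periodic2_iff:
  "periodic2 l1 l2 f \<longleftrightarrow> (\<forall>z. f (z + (l1, 0)) = f z) \<and> (\<forall>z. f (z + (0, l2)) = f z)"
  by (auto simp: periodic2_def)

lemma C1_differentiable: "C1 f \<Longrightarrow> f differentiable (at z)"
  unfolding C1_def by blast

lemma C1_has_derivative: "C1 f \<Longrightarrow> (f has_derivative frechet_derivative f (at z)) (at z)"
  using C1_differentiable frechet_derivative_works by blast

lemma C1_continuous: "C1 f \<Longrightarrow> continuous_on UNIV f"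
  by (simp add: C1_differentiable continuous_on_eq_continuous_at differentiable_imp_continuous_within)

lemma C1_continuous_partials: "C1 f \<Longrightarrow> continuous_on UNIV (dx f)" "C1 f \<Longrightarrow> continuous_on UNIV (dy f)"
  by (simp_all add: C1_def)

lemma periodic2_dx_dy:
  assumes "C1 f" "periodic2 l1 l2 f"
  shows "periodic2 l1 l2 (dx f)" "periodic2 l1 l2 (dy f)"
  using assms(2) frechet_derivative_shift[OF C1_differentiable[OF assms(1)]]
  unfolding periodic2_iff dx_def dy_def by metis+

section \<open>Sums, products and conjugates of C1 and C2 functions\<close>

lemma C1_add:
  assumes "C1 f" "C1 g"
  shows "C1 (\<lambda>z. f z + g z)" "dx (\<lambda>z. f z + g z) = (\<lambda>z. dx f z + dx g z)"
    "dy (\<lambda>z. f z + g z) = (\<lambda>z. dy f z + dy g z)"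
proof -
  have D: "((\<lambda>z. f z + g z) has_derivative
      (\<lambda>h. frechet_derivative f (at z) h + frechet_derivative g (at z) h)) (at z)" for z
    using assms by (intro has_derivative_add) (rule C1_has_derivative, assumption)+
  show dx: "dx (\<lambda>z. f z + g z) = (\<lambda>z. dx f z + dx g z)"
    and dy: "dy (\<lambda>z. f z + g z) = (\<lambda>z. dy f z + dy g z)"
    by (simp_all add: dx_def dy_def frechet_derivative_at[OF D, symmetric])
  show "C1 (\<lambda>z. f z + g z)"
    using assms D unfolding C1_def dx dy by (auto intro: continuous_on_add differentiableI)
qed

lemma C1_mult:
  assumes "C1 f" "C1 g"
  shows "C1 (\<lambda>z. f z * g z)" "dx (\<lambda>z. f z * g z) = (\<lambda>z. f z * dx g z + dx f z * g z)"
    "dy (\<lambda>z. f z * g z) = (\<lambda>z. f z * dy g z + dy f z * g z)"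
proof -
  have D: "((\<lambda>z. f z * g z) has_derivative
      (\<lambda>h. f z * frechet_derivative g (at z) h + frechet_derivative f (at z) h * g z)) (at z)" for z
    using assms by (intro has_derivative_mult) (rule C1_has_derivative, assumption)+
  show dx: "dx (\<lambda>z. f z * g z) = (\<lambda>z. f z * dx g z + dx f z * g z)"
    and dy: "dy (\<lambda>z. f z * g z) = (\<lambda>z. f z * dy g z + dy f z * g z)"
    by (simp_all add: dx_def dy_def frechet_derivative_at[OF D, symmetric])
  show "C1 (\<lambda>z. f z * g z)"
    using assms D assms[THEN C1_continuous] unfolding C1_def dx dy
    by (auto intro!: continuous_on_add continuous_on_mult intro: differentiableI)
qed

lemma C1_cnj:
  assumes "C1 f"
  shows "C1 (\<lambda>z. cnj (f z))" "dx (\<lambda>z. cnj (f z)) = (\<lambda>z. cnj (dx f z))"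
    "dy (\<lambda>z. cnj (f z)) = (\<lambda>z. cnj (dy f z))"
proof -
  have D: "((\<lambda>z. cnj (f z)) has_derivative (\<lambda>h. cnj (frechet_derivative f (at z) h))) (at z)" for z
    using assms by (intro has_derivative_cnj) (rule C1_has_derivative)
  show dx: "dx (\<lambda>z. cnj (f z)) = (\<lambda>z. cnj (dx f z))"
    and dy: "dy (\<lambda>z. cnj (f z)) = (\<lambda>z. cnj (dy f z))"
    by (simp_all add: dx_def dy_def frechet_derivative_at[OF D, symmetric])
  show "C1 (\<lambda>z. cnj (f z))"
    using assms D unfolding C1_def dx dy by (auto intro: continuous_on_cnj differentiableI)
qed

lemma C1_const: "C1 (\<lambda>z. c)" "dx (\<lambda>z. c) = (\<lambda>z. 0)" "dy (\<lambda>z. c) = (\<lambda>z. 0)"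
  by (simp_all add: C1_def dx_def dy_def)

lemma C2per_const: "(\<lambda>z. c) \<in> C2per l1 l2"
  by (simp add: C2per_def periodic2_def C1_const)

lemma C2per_mult: "f \<in> C2per l1 l2 \<Longrightarrow> g \<in> C2per l1 l2 \<Longrightarrow> (\<lambda>z. f z * g z) \<in> C2per l1 l2"
  by (auto simp: C2per_def periodic2_def C1_mult intro!: C1_add)

lemma C2per_cnj: "f \<in> C2per l1 l2 \<Longrightarrow> (\<lambda>z. cnj (f z)) \<in> C2per l1 l2"
  by (auto simp: C2per_def periodic2_def C1_cnj)

lemma C2per_add: "f \<in> C2per l1 l2 \<Longrightarrow> g \<in> C2per l1 l2 \<Longrightarrow> (\<lambda>z. f z + g z) \<in> C2per l1 l2"
  by (auto simp: C2per_def periodic2_def C1_add)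

text \<open>The summand 1 keeps the term at 0 finite and matches the weight 1 + eigenvalue used in
  \<open>summable_on_inverse_ev\<close>.\<close>

lemma summable_on_int_inverse_square:
  assumes "c > 0"
  shows "(\<lambda>m::int. 1 / (1 + c * (of_int m)\<^sup>2) :: real) summable_on UNIV"
proof -
  let ?g = "\<lambda>m::int. 1 / (1 + c * (of_int m)\<^sup>2) :: real"
  have bound: "1 / (1 + c * (real n)\<^sup>2) \<le> (1 / c) * inverse ((real n)\<^sup>2)" if "n \<ge> 1" for n :: nat
    proof -
    have "c * (real n)\<^sup>2 > 0"
      using that assms by simp
    then have "1 / (1 + c * (real n)\<^sup>2) \<le> 1 / (c * (real n)\<^sup>2)"
      by (intro divide_left_mono) (auto intro: mult_pos_pos)
    then show ?thesis
      by (simp add: field_simps)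
  qed
  have "summable (\<lambda>n. 1 / (1 + c * (real n)\<^sup>2))"
  proof (rule summable_comparison_test')
    show "summable (\<lambda>n. (1 / c) * inverse ((real n)\<^sup>2))"
      using inverse_power_summable[of 2, where 'a = real] by (intro summable_mult) simp
    show "norm (1 / (1 + c * (real n)\<^sup>2)) \<le> (1 / c) * inverse ((real n)\<^sup>2)" if "n \<ge> 1" for n
      using bound[OF that] assms by (simp add: add_nonneg_nonneg)
  qed
  then have n: "(\<lambda>n. 1 / (1 + c * (real n)\<^sup>2)) summable_on UNIV"
    using assms by (intro norm_summable_imp_summable_on) (simp add: add_nonneg_nonneg)
  have "?g summable_on range int" "?g summable_on range (\<lambda>n. - int n)"
    using n by (simp_all add: summable_on_reindex inj_on_def o_def)
  \<comment> \<open>0 lies in both ranges, so it is removed from the second to make the union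
    disjoint.\<close>
  then have "?g summable_on (range int \<union> (range (\<lambda>n. - int n) - range int))"
    by (intro summable_on_Un_disjoint) (auto intro: summable_on_subset_banach)
  moreover have "range int \<union> (range (\<lambda>n. - int n) - range int) = UNIV"
    by (auto, metis int_cases2 rangeI)
  ultimately show ?thesis
    by simp
qed

subsection \<open>Fourier coefficients and Bessel's inequality\<close>

context torus
begin

lemma l_nonzero [simp]: "l1 \<noteq> 0" "l2 \<noteq> 0"
  using l1_pos l2_pos by simp_all

lemma set_integrable_continuous:
  fixes F :: "real \<times> real \<Rightarrow> complex"
  assumes "continuous_on UNIV F"
  shows "set_integrable lborel (Omega l1 l2) F"
  unfolding set_integrable_def Omega_cbox
  by (intro borel_integrable_compact continuous_on_subset[OF assms]) simp_all

lemma mode_periodic: "periodic2 l1 l2 (e k)"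
  using mode_C2per[OF l1_pos l2_pos] by (simp add: C2per_def)

lemma mode_partial_x: "((\<lambda>x. e k (x, y)) has_vector_derivative mu1 k * e k (x, y)) (at x)"
  using has_vector_derivative_dx[of "e k" x y] mode_differentiable[of 1 l1 l2 k "(x, y)"]
    dx_mode[of 1 l1 l2 k] by simp

lemma mode_partial_y: "((\<lambda>y. e k (x, y)) has_vector_derivative mu2 k * e k (x, y)) (at y)"
  using has_vector_derivative_dy[of "e k" x y] mode_differentiable[of 1 l1 l2 k "(x, y)"]
    dy_mode[of 1 l1 l2 k] by simp

text \<open>Since \<open>mu1 k\<close> is imaginary, conjugating the mode flips its sign. So
  \<open>F' * cnj (e k) - mu1 k * (F * cnj (e k))\<close> is the x-derivative of a periodic function
  and integrates to 0.\<close>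

lemma coef_partial_x:
  assumes "continuous_on UNIV F" "continuous_on UNIV F'" "periodic2 l1 l2 F"
    and D: "\<And>x y. ((\<lambda>x. F (x, y)) has_vector_derivative F' (x, y)) (at x)"
  shows "coef F' k = mu1 k * coef F k"
proof -
  have "(LINT z:Omega l1 l2|lborel. F' z * cnj (e k z) - mu1 k * (F z * cnj (e k z))) = 0"
  proof (rule LINT_partial_x)
    show "continuous_on UNIV (\<lambda>z. F' z * cnj (e k z) - mu1 k * (F z * cnj (e k z)))"
      by (intro continuous_intros assms mode_continuous)
    show "periodic2 l1 l2 (\<lambda>z. F z * cnj (e k z))"
      using assms(3) mode_periodic[of k] by (simp add: periodic2_def)
    show "((\<lambda>x. F (x, y) * cnj (e k (x, y))) has_vector_derivative
        F' (x, y) * cnj (e k (x, y)) - mu1 k * (F (x, y) * cnj (e k (x, y)))) (at x)" for x y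
      using has_vector_derivative_mult[OF D has_vector_derivative_cnj[OF mode_partial_x]]
      by (simp add: algebra_simps)
  qed
  then have "inner2 F' (e k) - mu1 k * inner2 F (e k) = 0"
    unfolding ip_def set_integral_mult_right[symmetric]
    by (subst set_integral_diff(2)[symmetric])
      (auto intro!: set_integrable_continuous continuous_intros assms mode_continuous)
  then show ?thesis
    by (simp add: fcoeff_def)
qed

lemma coef_partial_y:
  assumes "continuous_on UNIV F" "continuous_on UNIV F'" "periodic2 l1 l2 F"
    and D: "\<And>x y. ((\<lambda>y. F (x, y)) has_vector_derivative F' (x, y)) (at y)"
  shows "coef F' k = mu2 k * coef F k"
proof -
  have "(LINT z:Omega l1 l2|lborel. F' z * cnj (e k z) - mu2 k * (F z * cnj (e k z))) = 0"
  proof (rule LINT_partial_y)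
    show "continuous_on UNIV (\<lambda>z. F' z * cnj (e k z) - mu2 k * (F z * cnj (e k z)))"
      by (intro continuous_intros assms mode_continuous)
    show "periodic2 l1 l2 (\<lambda>z. F z * cnj (e k z))"
      using assms(3) mode_periodic[of k] by (simp add: periodic2_def)
    show "((\<lambda>y. F (x, y) * cnj (e k (x, y))) has_vector_derivative
        F' (x, y) * cnj (e k (x, y)) - mu2 k * (F (x, y) * cnj (e k (x, y)))) (at y)" for x y
      using has_vector_derivative_mult[OF D has_vector_derivative_cnj[OF mode_partial_y]]
      by (simp add: algebra_simps)
  qed
  then have "inner2 F' (e k) - mu2 k * inner2 F (e k) = 0"
    unfolding ip_def set_integral_mult_right[symmetric]
    by (subst set_integral_diff(2)[symmetric])
      (auto intro!: set_integrable_continuous continuous_intros assms mode_continuous)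
  then show ?thesis
    by (simp add: fcoeff_def)
qed

lemma mu_eq_0_iff [simp]: "mu1 k = 0 \<longleftrightarrow> fst k = 0" "mu2 k = 0 \<longleftrightarrow> snd k = 0"
  using l1_pos l2_pos by auto

text \<open>Off k = 0 no exponential is integrated: differentiating the constant gives
  \<open>mu * coef = 0\<close> in both variables, and one of the two factors \<open>mu\<close> is
  nonzero.\<close>

lemma coef_const: "coef (\<lambda>z. c) k = (if k = 0 then c else 0)"
proof (cases "k = 0")
  case True
  have "inner2 (\<lambda>z. c) (e k) = c * V"
    using emeasure_Omega
    by (simp add: True ip_def set_lebesgue_integral_def content_Omega scaleR_conv_of_real)
  then show ?thesis
    using V_pos True by (simp add: fcoeff_def)
next
  case False
  have "mu1 k * coef (\<lambda>z. c) k = coef (\<lambda>z. 0) k" "mu2 k * coef (\<lambda>z. c) k = coef (\<lambda>z. 0) k"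
    by (subst coef_partial_x[symmetric] coef_partial_y[symmetric]; simp add: periodic2_def)+
  moreover have "coef (\<lambda>z. 0) k = 0"
    by (simp add: fcoeff_def ip_def)
  moreover have "fst k \<noteq> 0 \<or> snd k \<noteq> 0"
    using False by (auto simp: prod_eq_iff)
  ultimately show ?thesis
    using False mu_eq_0_iff[of k] by (metis mult_eq_0_iff)
qed

lemma coef_mode: "coef (e m) k = (if k = m then 1 else 0)"
  using coef_mode_mult[of m "\<lambda>z. 1" k] by (simp add: coef_const)

lemma ip_mode: "inner2 f (e k) = V * coef f k"
  using V_pos by (simp add: fcoeff_def)

lemma ip_mode_left: "inner2 (e k) f = V * cnj (coef f k)"
  by (subst ip_cnj) (simp add: ip_mode)

text \<open>\<open>p\<close> is the orthogonal projection of g onto the span of the modes in K; the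
  claim is that g - p has nonnegative squared norm. The factor \<open>V\<close> is the squared norm
  of a mode.\<close>

lemma Bessel_finite:
  assumes g: "bdd_meas g" and "finite K"
  shows "V * (\<Sum>k\<in>K. (cmod (coef g k))\<^sup>2) \<le> Re (inner2 g g)"
proof -
  define p where "p = (\<lambda>z. \<Sum>k\<in>K. coef g k * e k z)"
  let ?S = "complex_of_real (\<Sum>k\<in>K. (cmod (coef g k))\<^sup>2)"
  have bm: "bdd_meas p" "bdd_meas (\<lambda>z. coef g k * e k z)" for k
    unfolding p_def by (intro bdd_meas_sum bdd_meas_cmult bdd_meas_mode)+
  have ip_p: "inner2 p f = (\<Sum>k\<in>K. coef g k * (V * cnj (coef f k)))" if "bdd_meas f" for f
    unfolding p_def by (subst ip_sum_left) (simp_all add: bm that ip_cmult_left ip_mode_left)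
  have S: "coef g k * (V * cnj (coef g k)) = V * of_real ((cmod (coef g k))\<^sup>2)" for k
    using complex_norm_square[of "coef g k"] by (simp add: mult.left_commute)
  have coef_p: "coef p k = coef g k" if "k \<in> K" for k
    unfolding p_def using that \<open>finite K\<close>
    by (subst coef_sum) (auto simp: bm coef_cmult coef_mode if_distrib cong: if_cong)
  have pg: "inner2 p g = V * ?S"
    unfolding ip_p[OF g] S by (simp add: sum_distrib_left)
  have pp: "inner2 p p = V * ?S"
    using pg ip_p[OF g] ip_p[OF bm(1)] by (simp add: coef_p)
  have gp: "inner2 g p = V * ?S"
    by (subst ip_cnj) (simp add: pg)
  have "inner2 (\<lambda>z. g z - p z) (\<lambda>z. g z - p z) = inner2 g g - V * ?S"
    by (simp add: ip_diff_left ip_diff_right bdd_meas_diff g bm pg pp gp)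
  then have "Re (inner2 g g - V * ?S) \<ge> 0"
    using ip_self_nonneg by metis
  then show ?thesis
    by simp
qed

lemma Bessel_summable:
  assumes "bdd_meas g"
  shows "(\<lambda>k. (cmod (coef g k))\<^sup>2) summable_on UNIV"
proof (rule nonneg_bdd_above_summable_on)
  have "(\<Sum>k\<in>K. (cmod (coef g k))\<^sup>2) \<le> Re (inner2 g g) / V" if "finite K" for K
    using Bessel_finite[OF assms that] V_pos by (simp add: field_simps)
  then show "bdd_above (sum (\<lambda>k. (cmod (coef g k))\<^sup>2) ` {F. F \<subseteq> UNIV \<and> finite F})"
    by (auto simp: bdd_above_def)
qed simp

section \<open>Coefficients of derivatives and their decay\<close>

lemma C2per_bdd_meas: "f \<in> C2per l1 l2 \<Longrightarrow> bdd_meas f"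
  by (simp add: C2per_def C1_continuous continuous_periodic_bounded)

lemma coef_dx: "C1 f \<Longrightarrow> periodic2 l1 l2 f \<Longrightarrow> coef (dx f) k = mu1 k * coef f k"
  by (rule coef_partial_x)
    (simp_all add: C1_continuous C1_continuous_partials C1_differentiable has_vector_derivative_dx)

lemma coef_dy: "C1 f \<Longrightarrow> periodic2 l1 l2 f \<Longrightarrow> coef (dy f) k = mu2 k * coef f k"
  by (rule coef_partial_y)
    (simp_all add: C1_continuous C1_continuous_partials C1_differentiable has_vector_derivative_dy)

text \<open>Integration by parts twice in each variable is allowed because \<open>dx f\<close> and
  \<open>dy f\<close> are again C1 and periodic; \<open>mu1\<close> and \<open>mu2\<close> squared
  add up to -2 times the eigenvalue.\<close>

lemma opL_C2per:
  assumes "f \<in> C2per l1 l2"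
  shows "bdd_meas (opL f)" "coef (opL f) k = ev k * coef f k"
proof -
  have C: "C1 f" "C1 (dx f)" "C1 (dy f)" and per: "periodic2 l1 l2 f"
    using assms by (simp_all add: C2per_def)
  note per1 = periodic2_dx_dy[OF C(1) per]
  have bm: "bdd_meas (dx (dx f))" "bdd_meas (dy (dy f))"
    using C periodic2_dx_dy[OF C(2) per1(1)] periodic2_dx_dy[OF C(3) per1(2)]
    by (auto intro!: continuous_periodic_bounded simp: C1_def)
  then show "bdd_meas (opL f)"
    unfolding opL_def laplacian_def by (intro bdd_meas_cmult bdd_meas_add)
  have "coef (opL f) k = - (1 / 2) * (mu1 k * (mu1 k * coef f k) + mu2 k * (mu2 k * coef f k))"
    unfolding opL_def laplacian_def coef_cmult
    by (simp add: coef_add bm coef_dx coef_dy C per per1)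
  also have "\<dots> = ev k * coef f k"
    by (simp add: eigval_def power2_eq_square algebra_simps)
  finally show "coef (opL f) k = ev k * coef f k" .
qed

lemma ev_nonneg: "ev k \<ge> 0"
  by (simp add: eigval_def)

text \<open>The eigenvalue is p + q with p, q nonnegative, each depending on one index. From (1 +
  p)(1 + q) \<le> (1 + p + q)^2 the double series is dominated by a product of two single
  ones.\<close>

lemma summable_on_inverse_ev: "(\<lambda>k. 1 / (1 + ev k)\<^sup>2) summable_on UNIV"
proof -
  define A B where "A = (2 * pi\<^sup>2 / l1\<^sup>2)" and "B = (2 * pi\<^sup>2 / l2\<^sup>2)"
  have AB: "A > 0" "B > 0"
    using l1_pos l2_pos by (simp_all add: A_def B_def)
  let ?u = "\<lambda>m::int. 1 / (1 + A * (of_int m)\<^sup>2)" and ?v = "\<lambda>m::int. 1 / (1 + B * (of_int m)\<^sup>2)"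
  have nn: "?u m \<ge> 0" "?v m \<ge> 0" for m
    using AB by (simp_all add: add_nonneg_nonneg)
  have "(\<lambda>m. norm (?u m)) summable_on UNIV" "(\<lambda>m. norm (?v m)) summable_on UNIV"
    using nn summable_on_int_inverse_square AB by simp_all
  then have "(\<lambda>k. norm (case k of (m, n) \<Rightarrow> ?u m * ?v n)) summable_on UNIV \<times> UNIV"
    unfolding abs_summable_equivalent by (intro abs_summable_on_product) simp_all
  then have s: "(\<lambda>k. ?u (fst k) * ?v (snd k)) summable_on UNIV"
    unfolding UNIV_Times_UNIV case_prod_beta by (rule abs_summable_summable)
  have "1 / (1 + ev k)\<^sup>2 \<le> ?u (fst k) * ?v (snd k)" for k
  proof -
    define p q where "p = A * (of_int (fst k))\<^sup>2" and "q = B * (of_int (snd k))\<^sup>2"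
    have pq: "p \<ge> 0" "q \<ge> 0"
      using AB by (simp_all add: p_def q_def)
    have ev: "ev k = p + q"
      by (simp add: eigval_def p_def q_def A_def B_def power_divide algebra_simps)
    have "(1 + p) * (1 + q) \<le> (1 + p + q) * (1 + p + q)"
      using pq by (intro mult_mono) auto
    then show ?thesis
      unfolding ev p_def[symmetric] q_def[symmetric] using pq
      by (simp add: power2_eq_square add.assoc frac_le)
  qed
  then show ?thesis
    using s by (intro summable_on_comparison_test[OF s]) auto
qed

text \<open>The coefficients of f are those of \<open>f + opL f\<close> divided by 1 + eigenvalue.
  Both factors are square summable, the first by Bessel, and 2xy \<le> x^2 + y^2 bounds their
  product. Adding f to \<open>opL f\<close> avoids division by the eigenvalue 0 of the constant
  mode.\<close>

lemma coef_abs_summable: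
  assumes "f \<in> C2per l1 l2"
  shows "(\<lambda>k. cmod (coef f k)) summable_on UNIV"
proof -
  let ?g = "\<lambda>z. f z + opL f z"
  note bm = C2per_bdd_meas[OF assms] opL_C2per(1)[OF assms]
  have "(\<lambda>k. (cmod (coef ?g k))\<^sup>2 + 1 / (1 + ev k)\<^sup>2) summable_on UNIV"
    by (intro summable_on_add Bessel_summable summable_on_inverse_ev bdd_meas_add bm)
  moreover have "cmod (coef f k) \<le> (cmod (coef ?g k))\<^sup>2 + 1 / (1 + ev k)\<^sup>2" for k
  proof -
    have "coef ?g k = of_real (1 + ev k) * coef f k"
      by (simp add: coef_add bm opL_C2per[OF assms] algebra_simps)
    then have g: "cmod (coef ?g k) = (1 + ev k) * cmod (coef f k)"
      using ev_nonneg[of k] by (simp only: norm_mult norm_of_real)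
    have pos: "1 + ev k > 0"
      using ev_nonneg[of k] by simp
    have "2 * cmod (coef f k) = 2 * (cmod (coef ?g k)) * (1 / (1 + ev k))"
      using pos by (simp add: g)
    also have "\<dots> \<le> (cmod (coef ?g k))\<^sup>2 + (1 / (1 + ev k))\<^sup>2"
      by (rule sum_squares_bound)
    finally have "2 * cmod (coef f k) \<le> (cmod (coef ?g k))\<^sup>2 + 1 / (1 + ev k)\<^sup>2"
      by (simp add: power_divide)
    then show ?thesis
      using norm_ge_zero[of "coef f k"] by linarith
  qed
  ultimately show ?thesis
    by (rule summable_on_comparison_test) simp_all
qed

end

subsection \<open>Pointwise convergence and Parseval's identity\<close>

text \<open>Jordan's inequality with 1/2 in place of the sharp 2/pi. For the half angle s one has
  sin(2s) = 2 tan s cos^2 s, where tan s \<ge> s, and cos^2 s \<ge> 1/2 because s \<le>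
  pi/4.\<close>

lemma abs_le_2_abs_sin:
  fixes t :: real
  assumes "\<bar>t\<bar> \<le> pi / 2"
  shows "\<bar>t\<bar> \<le> 2 * \<bar>sin t\<bar>"
proof -
  define s where "s = \<bar>t\<bar> / 2"
  have s: "0 \<le> s" "s \<le> pi / 4"
    using assms by (simp_all add: s_def)
  have cos_s: "cos s \<ge> sqrt 2 / 2"
    using cos_monotone_0_pi_le[of s "pi / 4"] s by (simp add: cos_45)
  then have cos_pos: "cos s > 0"
    by (rule less_le_trans[rotated]) simp
  have "s < pi / 2"
    using s pi_gt_zero by linarith
  then have "s \<le> tan s"
    using abs_arctan_le[of "tan s"] s cos_pos arctan_tan[of s] tan_pos_pi2_le[of s] by simp
  moreover have "1 / 2 \<le> (cos s)\<^sup>2"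
    using power_mono[OF cos_s, of 2] by (simp add: power_divide)
  ultimately have "s * (1 / 2) \<le> tan s * (cos s)\<^sup>2"
    using s by (intro mult_mono) auto
  also have "tan s * (cos s)\<^sup>2 = sin s * cos s"
    using cos_pos by (simp add: tan_def power2_eq_square)
  finally have "2 * s \<le> 2 * (2 * sin s * cos s)"
    by (simp add: mult_ac)
  also have "2 * sin s * cos s = sin \<bar>t\<bar>"
    using sin_double[of s] by (simp add: s_def)
  also have "sin \<bar>t\<bar> \<le> \<bar>sin t\<bar>"
    by (auto simp: abs_if)
  finally show ?thesis
    by (simp add: s_def)
qed

text \<open>The exponential factor vanishes only at the translates of x0 by periods, and only to
  first order there, so it dominates a periodic Lipschitz function that vanishes at the same points.
  This bounds the quotients of \<open>C2per_has_sum\<close>.\<close>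

lemma periodic_lipschitz_le_exp:
  fixes p :: "real \<Rightarrow> complex"
  assumes "l > 0" and period: "\<And>x. p (x + l) = p x"
    and lip: "\<And>x. cmod (p x - p x0) \<le> K * \<bar>x - x0\<bar>" and "K \<ge> 0"
  shows "cmod (p x - p x0) \<le> K * l / pi * cmod (exp (\<i> * of_real (2 * pi * (x - x0) / l)) - 1)"
proof -
  \<comment> \<open>The nearest multiple of the period: then |u| \<le> l/2, and the half angle pi u
    / l stays within pi/2, as \<open>abs_le_2_abs_sin\<close> demands.\<close>
  define m where "m = round ((x - x0) / l)"
  define u where "u = (x - x0) - of_int m * l"
  have "\<bar>(x - x0) / l - of_int m\<bar> \<le> 1 / 2"
    unfolding m_def using of_int_round_abs_le[of "(x - x0) / l"] by (simp add: abs_minus_commute)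
  moreover have u: "(x - x0) / l - of_int m = u / l"
    using \<open>l > 0\<close> by (simp add: u_def field_simps)
  ultimately have u_le: "\<bar>u\<bar> / l \<le> 1 / 2"
    using \<open>l > 0\<close> by (simp add: abs_divide)
  interpret periodic_fun_simple p l
    by unfold_locales (rule period)
  have "p (x0 + u + of_int m * l) = p (x0 + u)"
    by (rule plus_of_int)
  then have "p x = p (x0 + u)"
    by (simp add: u_def)
  then have 1: "cmod (p x - p x0) \<le> K * \<bar>u\<bar>"
    using lip[of "x0 + u"] by simp
  have "\<i> * complex_of_real (2 * pi * (x - x0) / l) = \<i> * of_real (2 * pi * u / l) + (2 * of_int m * pi) * \<i>"
    using \<open>l > 0\<close> by (simp add: u_def field_simps)
  moreover have "exp (complex_of_real (2 * of_int m * pi) * \<i>) = 1"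
    unfolding exp_eq_1 by (auto intro!: exI[of _ m])
  ultimately have "cmod (exp (\<i> * of_real (2 * pi * (x - x0) / l)) - 1) = 2 * \<bar>sin (2 * pi * u / l / 2)\<bar>"
    by (simp only: exp_add mult_1_right dist_exp_i_1)
  also have "\<dots> \<ge> \<bar>2 * pi * u / l / 2\<bar>"
  proof (rule abs_le_2_abs_sin)
    have "\<bar>2 * pi * u / l / 2\<bar> = pi * (\<bar>u\<bar> / l)"
      using \<open>l > 0\<close> by (simp add: abs_mult)
    also have "\<dots> \<le> pi * (1 / 2)"
      using u_le by (intro mult_left_mono) auto
    finally show "\<bar>2 * pi * u / l / 2\<bar> \<le> pi / 2"
      by simp
  qed
  finally have "pi * \<bar>u\<bar> / l \<le> cmod (exp (\<i> * of_real (2 * pi * (x - x0) / l)) - 1)"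
    using \<open>l > 0\<close> by (simp add: abs_mult)
  then have "K * l / pi * (pi * \<bar>u\<bar> / l) \<le> K * l / pi * cmod (exp (\<i> * of_real (2 * pi * (x - x0) / l)) - 1)"
    using \<open>l > 0\<close> \<open>K \<ge> 0\<close> by (intro mult_left_mono) auto
  with 1 show ?thesis
    using \<open>l > 0\<close> by simp
qed

text \<open>Over a symmetric interval only two boundary terms survive, and square summability sends
  both to 0.\<close>

lemma telescoping_has_sum_0:
  fixes d :: "int \<Rightarrow> complex"
  assumes "((\<lambda>k. d (k - 1) - d k) has_sum S) UNIV"
    and "(\<lambda>k. (cmod (d k))\<^sup>2) summable_on UNIV"
  shows "S = 0"
proof -
  have lim: "(\<lambda>n::nat. d (j n)) \<longlonglongrightarrow> 0" if "inj j" for j :: "nat \<Rightarrow> int"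
  proof -
    have "(\<lambda>k. (cmod (d k))\<^sup>2) summable_on range j"
      using assms(2) by (rule summable_on_subset_banach) simp
    then have "(\<lambda>n. (cmod (d (j n)))\<^sup>2) summable_on UNIV"
      using that by (simp add: summable_on_reindex o_def)
    then have "(\<lambda>n. (cmod (d (j n)))\<^sup>2) \<longlonglongrightarrow> 0"
      by (intro summable_LIMSEQ_zero summable_on_imp_summable)
    from tendsto_real_sqrt[OF this] show ?thesis
      by (simp add: tendsto_norm_zero_iff)
  qed
  \<comment> \<open>\<open>has_sum\<close> is a limit over all finite sets; symmetric intervals are
    cofinal among them, so the sum may be evaluated along these.\<close>
  have "filterlim (\<lambda>n. {- int n..int n}) (finite_subsets_at_top UNIV) sequentially"
    unfolding filterlim_finite_subsets_at_top
  proof (intro allI impI)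
    fix X :: "int set"
    assume "finite X \<and> X \<subseteq> UNIV"
    then have "finite (abs ` X)"
      by simp
    then have "\<bar>x\<bar> \<le> Max (insert 0 (abs ` X))" if "x \<in> X" for x
      using that by simp
    then have "X \<subseteq> {- int n..int n}" if "n \<ge> nat (Max (insert 0 (abs ` X)))" for n
      using that by (fastforce simp: abs_le_iff)
    then show "\<forall>\<^sub>F n in sequentially. finite {- int n..int n} \<and> X \<subseteq> {- int n..int n} \<and> {- int n..int n} \<subseteq> UNIV"
      unfolding eventually_sequentially by auto
  qed
  with assms(1) have "(\<lambda>n. \<Sum>k\<in>{- int n..int n}. d (k - 1) - d k) \<longlonglongrightarrow> S"
    unfolding has_sum_def by (rule filterlim_compose)
  moreover have "(\<Sum>k\<in>{- int n..int n}. d (k - 1) - d k) = d (- int n - 1) - d (int n)" for n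
  proof (induction n)
    case (Suc n)
    have "{- int (Suc n)..int (Suc n)} = insert (- int n - 1) (insert (int n + 1) {- int n..int n})"
      by auto
    then show ?case
      using Suc by (simp add: algebra_simps)
  qed simp
  moreover have "(\<lambda>n. d (- int n - 1) - d (int n)) \<longlonglongrightarrow> 0 - 0"
    by (intro tendsto_diff lim) (simp_all add: inj_on_def)
  ultimately show ?thesis
    using LIMSEQ_unique by fastforce
qed

context torus
begin

text \<open>The partial derivatives are continuous and periodic, hence bounded; the mean value
  inequality is applied along horizontal and vertical lines.\<close>

lemma C2per_lipschitz:
  assumes "f \<in> C2per l1 l2"
  obtains K where "K \<ge> 0" "\<And>x x' y. cmod (f (x, y) - f (x', y)) \<le> K * \<bar>x - x'\<bar>"
    "\<And>x y y'. cmod (f (x, y) - f (x, y')) \<le> K * \<bar>y - y'\<bar>"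
proof -
  have C: "C1 f" "periodic2 l1 l2 f"
    using assms by (simp_all add: C2per_def)
  obtain A where A: "A \<ge> 0" "\<And>z. cmod (dx f z) \<le> A"
    using bdd_measE[OF continuous_periodic_bounded] periodic2_dx_dy[OF C] C1_continuous_partials[OF C(1)]
    by blast
  obtain B where B: "B \<ge> 0" "\<And>z. cmod (dy f z) \<le> B"
    using bdd_measE[OF continuous_periodic_bounded] periodic2_dx_dy[OF C] C1_continuous_partials[OF C(1)]
    by blast
  have lip: "cmod (p s - p s') \<le> M * \<bar>s - s'\<bar>"
    if "\<And>t. (p has_vector_derivative p' t) (at t)" "\<And>t. cmod (p' t) \<le> M"
    for p p' :: "real \<Rightarrow> complex" and M s s'
  proof -
    have "cmod (p s - p s') \<le> M * norm (s - s')"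
    proof (rule differentiable_bound)
      show "(p has_derivative (\<lambda>h. h *\<^sub>R p' t)) (at t within UNIV)" for t
        using that(1)[of t] by (simp add: has_vector_derivative_def)
      show "onorm (\<lambda>h. h *\<^sub>R p' t) \<le> M" for t
        using that(2)[of t] by (intro onorm_le) (auto simp: mult.commute[of M] intro: mult_left_mono)
    qed auto
    then show ?thesis
      by simp
  qed
  show thesis
  proof
    show "max A B \<ge> 0"
      using A by simp
    show "cmod (f (x, y) - f (x', y)) \<le> max A B * \<bar>x - x'\<bar>" for x x' y
      using A B C by (intro lip[of "\<lambda>t. f (t, y)" "\<lambda>t. dx f (t, y)"] has_vector_derivative_dx C1_differentiable)
        (auto intro: le_max_iff_disj[THEN iffD2])
    show "cmod (f (x, y) - f (x, y')) \<le> max A B * \<bar>y - y'\<bar>" for x y y'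
      using A B C by (intro lip[of "\<lambda>t. f (x, t)" "\<lambda>t. dy f (x, t)"] has_vector_derivative_dy C1_differentiable)
        (auto intro: le_max_iff_disj[THEN iffD2])
  qed
qed

text \<open>Chernoff's argument: both quotients below are bounded, so their coefficients are square
  summable, while the coefficients of \<open>f - f z0\<close> are telescoping differences of them.  The first
  quotient depends on \<open>x\<close> only, so summing over the second index first leaves a single row.\<close>

lemma C2per_has_sum:
  assumes f: "f \<in> C2per l1 l2"
  shows "((\<lambda>k. coef f k * e k z0) has_sum f z0) UNIV"
proof -
  obtain x0 y0 where z0: "z0 = (x0, y0)"
    by (cases z0)
  have cont: "continuous_on UNIV f" and per: "periodic2 l1 l2 f"
    using f by (simp_all add: C2per_def C1_continuous)
  obtain K where K: "K \<ge> 0" "\<And>x x' y. cmod (f (x, y) - f (x', y)) \<le> K * \<bar>x - x'\<bar>"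
    "\<And>x y y'. cmod (f (x, y) - f (x, y')) \<le> K * \<bar>y - y'\<bar>"
    using C2per_lipschitz[OF f] by blast
  define h where "h = (\<lambda>z. f z - f z0)"
  \<comment> \<open>The increment from \<open>z0\<close> to \<open>z\<close> is split along a
    horizontal and then a vertical segment: \<open>F\<close> is the horizontal part, and the
    remainder vanishes on the line y = y0.\<close>
  define F where "F = (\<lambda>z :: real \<times> real. f (fst z, y0) - f z0)"
  define E1 where "E1 = (\<lambda>z. e (1, 0) z * cnj (e (1, 0) z0))"
  define E2 where "E2 = (\<lambda>z. e (0, 1) z * cnj (e (0, 1) z0))"
  define g1 where "g1 = (\<lambda>z. F z / (E1 z - 1))"
  define g2 where "g2 = (\<lambda>z :: real \<times> real. (f z - f (fst z, y0)) / (E2 z - 1))"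
  define c where "c = (\<lambda>k. coef h k * e k z0)"
  define G1 where "G1 = (\<lambda>k. coef g1 k * e k z0)"
  define G2 where "G2 = (\<lambda>k. coef g2 k * e k z0)"
  define B where "B = (\<lambda>k. coef F k * e k z0)"

  have E1: "E1 (x, y) = exp (\<i> * of_real (2 * pi * (x - x0) / l1))" for x y
    unfolding E1_def z0 mode_uminus[symmetric] unfolding mode_def exp_add[symmetric]
    by (rule arg_cong[where f = exp]) (simp add: field_simps)
  have E2: "E2 (x, y) = exp (\<i> * of_real (2 * pi * (y - y0) / l2))" for x y
    unfolding E2_def z0 mode_uminus[symmetric] unfolding mode_def exp_add[symmetric]
    by (rule arg_cong[where f = exp]) (simp add: field_simps)
  have le1: "cmod (F z) \<le> K * l1 / pi * cmod (E1 z - 1)" for z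
    using periodic_lipschitz_le_exp[of l1 "\<lambda>x. f (x, y0)" x0 K "fst z"] K l1_pos per
    by (cases z) (simp add: F_def E1 z0 periodic2_def)
  have le2: "cmod (f z - f (fst z, y0)) \<le> K * l2 / pi * cmod (E2 z - 1)" for z
    using periodic_lipschitz_le_exp[of l2 "\<lambda>y. f (fst z, y)" y0 K "snd z"] K l2_pos per
    by (cases z) (simp add: E2 periodic2_def)
  have contF: "continuous_on UNIV F" and cont2: "continuous_on UNIV (\<lambda>z. f (fst z, y0))"
    unfolding F_def by (auto intro!: continuous_intros continuous_on_compose2[OF cont])
  have contE: "continuous_on UNIV E1" "continuous_on UNIV E2"
    unfolding E1_def E2_def by (intro continuous_intros mode_continuous)+
  note meas = cont contF cont2 contE
  have g1: "bdd_meas g1"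
  proof (rule bdd_measI)
    show "g1 \<in> borel_measurable borel"
      unfolding g1_def using meas[THEN borel_measurable_continuous_onI] by measurable
    show "cmod (g1 z) \<le> K * l1 / pi" for z
      using le1[of z] K l1_pos by (cases "E1 z = 1") (simp_all add: g1_def norm_divide divide_le_eq)
  qed
  have g2: "bdd_meas g2"
  proof (rule bdd_measI)
    show "g2 \<in> borel_measurable borel"
      unfolding g2_def using meas[THEN borel_measurable_continuous_onI] by measurable
    show "cmod (g2 z) \<le> K * l2 / pi" for z
      using le2[of z] K l2_pos by (cases "E2 z = 1") (simp_all add: g2_def norm_divide divide_le_eq)
  qed
  \<comment> \<open>Where \<open>E1 z = 1\<close> the quotient is 0 by convention, and
    \<open>le1\<close> forces \<open>F z = 0\<close> too, so the identity survives.\<close>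
  have "F z = (E1 z - 1) * g1 z" for z
    using le1[of z] by (cases "E1 z = 1") (simp_all add: g1_def)
  then have F_eq: "F z = E1 z * g1 z - g1 z" for z
    by (simp add: left_diff_distrib)
  have h_eq: "h z = (E2 z * g2 z - g2 z) + F z" for z
  proof -
    have "f z - f (fst z, y0) = (E2 z - 1) * g2 z"
      using le2[of z] by (cases "E2 z = 1") (simp_all add: g2_def)
    then show ?thesis
      by (simp add: h_def F_def algebra_simps)
  qed

  have mode_shift: "cnj (e m z0) * e k z0 = e (k - m) z0" for k m
    using mode_add[of k "- m" z0] by (simp add: mode_uminus)
  \<comment> \<open>Weighting each coefficient by \<open>e k z0\<close> absorbs the constant
    \<open>cnj (e m z0)\<close>, so that a pure difference of one sequence remains.\<close>
  have coef_shift: "coef (\<lambda>z. (e m z * cnj (e m z0)) * g z - g z) k * e k z0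
      = coef g (k - m) * e (k - m) z0 - coef g k * e k z0" if "bdd_meas g" for g m k
  proof -
    have "coef (\<lambda>z. (e m z * cnj (e m z0)) * g z - g z) k
        = coef (\<lambda>z. cnj (e m z0) * (e m z * g z) - g z) k"
      by (simp add: mult_ac)
    also have "\<dots> = cnj (e m z0) * coef g (k - m) - coef g k"
      by (simp add: coef_diff coef_cmult coef_mode_mult bdd_meas_cmult bdd_meas_mult bdd_meas_mode that)
    finally have *: "coef (\<lambda>z. (e m z * cnj (e m z0)) * g z - g z) k
        = cnj (e m z0) * coef g (k - m) - coef g k" .
    show ?thesis
      unfolding * mode_shift[symmetric] by (simp add: algebra_simps)
  qed
  have bF: "bdd_meas F"
    unfolding F_eq[abs_def] E1_def by (intro bdd_meas_diff bdd_meas_mult bdd_meas_cnj bdd_meas_mode bdd_meas_const g1)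
  have B_eq: "B k = G1 (k - (1, 0)) - G1 k" for k
    unfolding B_def G1_def F_eq[abs_def] E1_def by (rule coef_shift[OF g1])
  have c_eq: "c k = (G2 (k - (0, 1)) - G2 k) + B k" for k
  proof -
    have "coef h k = coef (\<lambda>z. E2 z * g2 z - g2 z) k + coef F k"
      unfolding h_eq[abs_def] E2_def
      by (intro coef_add bF bdd_meas_diff bdd_meas_mult bdd_meas_cnj bdd_meas_mode bdd_meas_const g2)
    then show ?thesis
      using coef_shift[OF g2, of "(0, 1)" k] by (simp add: c_def G2_def B_def E2_def algebra_simps)
  qed
  \<comment> \<open>\<open>F\<close> does not depend on y, so its y-derivative is 0, while
    \<open>mu2\<close> is nonzero for these indices.\<close>
  have B_0: "B (m, n) = 0" if "n \<noteq> 0" for m n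
  proof -
    have "coef (\<lambda>z. 0) (m, n) = mu2 (m, n) * coef F (m, n)"
      using contF per by (intro coef_partial_y) (simp_all add: F_def periodic2_def)
    then show ?thesis
      using that mu_eq_0_iff(2)[of "(m, n)"] by (simp add: coef_const B_def)
  qed
  have G_summable: "(\<lambda>k. (cmod (G1 k))\<^sup>2) summable_on UNIV" "(\<lambda>k. (cmod (G2 k))\<^sup>2) summable_on UNIV"
    using Bessel_summable[OF g1] Bessel_summable[OF g2] by (simp_all add: G1_def G2_def norm_mult)

  have h: "h \<in> C2per l1 l2"
    using C2per_add[OF f C2per_const[of "- f z0"]] by (simp add: h_def)
  \<comment> \<open>Telescoping only identifies the value of a sum. Its existence, and the right to
    sum row by row, come from absolute summability.\<close>
  have "(\<lambda>k. cmod (c k)) summable_on UNIV"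
    using coef_abs_summable[OF h] by (simp add: c_def norm_mult)
  then have c_summable: "c summable_on UNIV"
    by (rule abs_summable_summable)
  then obtain S where S: "(c has_sum S) (UNIV \<times> UNIV)"
    by (auto simp: summable_on_def)
  have row: "((\<lambda>n. c (m, n)) has_sum B (m, 0)) UNIV" for m
  proof -
    have "(\<lambda>n. c (m, n)) summable_on UNIV"
      using c_summable by (intro summable_on_SigmaD1[where A = UNIV and f = "\<lambda>m n. c (m, n)"]) auto
    then obtain r where r: "((\<lambda>n. c (m, n)) has_sum r) UNIV"
      by (auto simp: summable_on_def)
    have "((\<lambda>n. B (m, n)) has_sum B (m, 0)) UNIV"
      by (rule has_sum_finite_neutralI[where B = "{0}"]) (auto simp: B_0)
    from has_sum_add[OF r has_sum_cmult_right[OF this, of "- 1"]]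
    have "((\<lambda>n. G2 (m, n - 1) - G2 (m, n)) has_sum r - B (m, 0)) UNIV"
      by (simp add: c_eq)
    moreover have "(\<lambda>n. (cmod (G2 (m, n)))\<^sup>2) summable_on UNIV"
    proof -
      have "(\<lambda>k. (cmod (G2 k))\<^sup>2) summable_on range (Pair m)"
        using G_summable(2) by (rule summable_on_subset_banach) simp
      then show ?thesis
        by (simp add: summable_on_reindex inj_on_def o_def)
    qed
    ultimately have "r - B (m, 0) = 0"
      by (rule telescoping_has_sum_0)
    with r show ?thesis
      by simp
  qed
  have "((\<lambda>m. B (m, 0)) has_sum S) UNIV"
    using has_sum_Sigma'[OF S row] .
  then have "((\<lambda>m. G1 (m - 1, 0) - G1 (m, 0)) has_sum S) UNIV"
    by (simp add: B_eq)
  moreover have "(\<lambda>m. (cmod (G1 (m, 0)))\<^sup>2) summable_on UNIV"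
  proof -
    have "(\<lambda>k. (cmod (G1 k))\<^sup>2) summable_on range (\<lambda>m. (m, 0))"
      using G_summable(1) by (rule summable_on_subset_banach) simp
    then show ?thesis
      by (simp add: summable_on_reindex inj_on_def o_def)
  qed
  ultimately have "S = 0"
    by (rule telescoping_has_sum_0)
  with S have "(c has_sum 0) UNIV"
    by simp
  \<comment> \<open>The subtracted constant \<open>f z0\<close> is put back; its series has the
    single term k = 0.\<close>
  moreover have "((\<lambda>k. coef (\<lambda>z. f z0) k * e k z0) has_sum f z0) UNIV"
    by (rule has_sum_finite_neutralI[where B = "{0}"]) (auto simp: coef_const)
  ultimately have "((\<lambda>k. c k + coef (\<lambda>z. f z0) k * e k z0) has_sum 0 + f z0) UNIV"
    by (rule has_sum_add)
  then show ?thesis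
    by (simp add: c_def h_def coef_diff C2per_bdd_meas[OF f] bdd_meas_const algebra_simps)
qed

text \<open>By the Weierstrass M-test the series converges uniformly, and on a rectangle of finite
  measure uniform limits pass through the inner product with a bounded function.\<close>

lemma ip_series:
  assumes a: "(\<lambda>k. cmod (a k)) summable_on UNIV"
  defines "u \<equiv> (\<lambda>z. \<Sum>\<^sub>\<infinity>k. a k * e k z)"
  shows "bdd_meas u" and "bdd_meas g \<Longrightarrow> ((\<lambda>k. a k * inner2 (e k) g) has_sum inner2 u g) UNIV"
proof -
  let ?s = "\<lambda>K z. \<Sum>k\<in>K. a k * e k z"
  have unif: "uniform_limit UNIV ?s u (finite_subsets_at_top UNIV)"
    unfolding u_def using a by (intro Weierstrass_m_test_general) (simp_all add: norm_mult)
  have abs: "(\<lambda>k. cmod (a k * e k z)) summable_on UNIV" for z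
    using a by (simp add: norm_mult)
  show bu: "bdd_meas u"
  proof (rule bdd_measI)
    have "continuous_on UNIV u"
      by (rule uniform_limit_theorem[OF _ unif])
        (auto intro!: always_eventually continuous_intros mode_continuous)
    then show "u \<in> borel_measurable borel"
      by (rule borel_measurable_continuous_onI)
    show "cmod (u z) \<le> (\<Sum>\<^sub>\<infinity>k. cmod (a k))" for z
      using norm_infsum_bound[OF abs, of z] by (simp add: u_def norm_mult)
  qed
  assume g: "bdd_meas g"
  obtain C where C: "C \<ge> 0" "\<And>z. cmod (g z) \<le> C"
    using bdd_measE[OF g] by blast
  have bs: "bdd_meas (\<lambda>z. a k * e k z)" for k
    by (intro bdd_meas_cmult bdd_meas_mode)
  have "((\<lambda>K. inner2 (?s K) g) \<longlongrightarrow> inner2 u g) (finite_subsets_at_top UNIV)"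
  proof (rule tendstoI)
    fix \<epsilon> :: real
    assume "\<epsilon> > 0"
    \<comment> \<open>The summand 1 keeps the denominator positive when \<open>C = 0\<close> and
      makes the final estimate strict.\<close>
    define \<delta> where "\<delta> = \<epsilon> / (C * V + 1)"
    have D: "C * V + 1 > 0"
      using C V_pos by (simp add: add_nonneg_pos)
    have "\<delta> > 0"
      using D \<open>\<epsilon> > 0\<close> by (simp add: \<delta>_def)
    with unif have "\<forall>\<^sub>F K in finite_subsets_at_top UNIV. \<forall>z\<in>UNIV. dist (?s K z) (u z) < \<delta>"
      by (rule uniform_limitD)
    then show "\<forall>\<^sub>F K in finite_subsets_at_top UNIV. dist (inner2 (?s K) g) (inner2 u g) < \<epsilon>"
    proof eventually_elim
      case (elim K)
      have "inner2 (?s K) g - inner2 u g = inner2 (\<lambda>z. ?s K z - u z) g"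
        by (intro ip_diff_left[symmetric] bdd_meas_sum bs bu g)
      moreover have "cmod (inner2 (\<lambda>z. ?s K z - u z) g) \<le> \<delta> * C * V"
        using elim C
        by (intro ip_norm_le bdd_meas_diff bdd_meas_sum bs bu g) (auto simp: dist_norm less_imp_le)
      ultimately have "dist (inner2 (?s K) g) (inner2 u g) \<le> \<delta> * (C * V)"
        by (simp add: dist_norm mult.assoc)
      also have "\<dots> < \<delta> * (C * V + 1)"
        using \<open>\<delta> > 0\<close> by simp
      also have "\<dots> = \<epsilon>"
        using D by (simp add: \<delta>_def)
      finally show ?case .
    qed
  qed
  moreover have "inner2 (?s K) g = (\<Sum>k\<in>K. a k * inner2 (e k) g)" for K
    by (simp add: ip_sum_left bs g ip_cmult_left)
  ultimately show "((\<lambda>k. a k * inner2 (e k) g) has_sum inner2 u g) UNIV"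
    by (simp add: has_sum_def)
qed

lemma coef_series:
  assumes a: "(\<lambda>k. cmod (a k)) summable_on UNIV"
  shows "coef (\<lambda>z. \<Sum>\<^sub>\<infinity>k. a k * e k z) k = a k"
proof -
  have "((\<lambda>m. a m * inner2 (e m) (e k)) has_sum a k * V) UNIV"
    by (rule has_sum_finite_neutralI[where B = "{k}"]) (auto simp: ip_mode coef_mode)
  from has_sum_unique[OF ip_series(2)[OF a bdd_meas_mode] this] show ?thesis
    by (simp add: fcoeff_def)
qed

text \<open>The regularity sits on one side only, so that g may be \<open>opL\<close> of a C2
  function, which is merely known to be bounded and measurable.\<close>

lemma Parseval:
  assumes f: "f \<in> C2per l1 l2" and g: "bdd_meas g"
  shows "((\<lambda>k. V * (coef f k * cnj (coef g k))) has_sum inner2 f g) UNIV"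
proof -
  have "f = (\<lambda>z. \<Sum>\<^sub>\<infinity>k. coef f k * e k z)"
    using infsumI[OF C2per_has_sum[OF f]] by metis
  then have "((\<lambda>k. coef f k * inner2 (e k) g) has_sum inner2 f g) UNIV"
    using ip_series(2)[OF coef_abs_summable[OF f] g] by simp
  then show ?thesis
    by (simp add: ip_mode_left mult_ac)
qed

text \<open>Unimodular factors preserve absolute summability, so the defining series is covered by
  \<open>ip_series\<close> and \<open>coef_series\<close>.\<close>

lemma exp_iL_C2per:
  assumes f: "f \<in> C2per l1 l2"
  shows "bdd_meas (exp_iL l1 l2 t f)"
    and "coef (exp_iL l1 l2 t f) k = exp (\<i> * of_real (ev k * t)) * coef f k"
proof -
  have *: "(\<lambda>k. cmod (exp (\<i> * of_real (ev k * t)) * coef f k)) summable_on UNIV"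
    using coef_abs_summable[OF f] by (simp add: norm_mult)
  show "bdd_meas (exp_iL l1 l2 t f)"
    unfolding exp_iL_def by (rule ip_series(1)[OF *])
  show "coef (exp_iL l1 l2 t f) k = exp (\<i> * of_real (ev k * t)) * coef f k"
    unfolding exp_iL_def by (rule coef_series[OF *])
qed

end

subsection \<open>Conservation laws of the scheme\<close>

text \<open>Substituting the stages for p in the cross terms produces double sums in the products of
  the \<open>y i\<close>, which the coefficient condition cancels against the term in \<tau>^2. A
  general inner product space serves both the complex Fourier coefficients and the real variable
  q.\<close>

lemma RK_quadratic_identity:
  fixes x y :: "'i \<Rightarrow> 'v::real_inner" and a :: "'i \<Rightarrow> 'i \<Rightarrow> real"
  assumes ab: "\<And>i j. i \<in> I \<Longrightarrow> j \<in> I \<Longrightarrow> b i * a i j + b j * a j i = b i * b j"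
    and x: "\<And>i. i \<in> I \<Longrightarrow> x i = p + \<tau> *\<^sub>R (\<Sum>j\<in>I. a i j *\<^sub>R y j)"
    and p': "p' = p + \<tau> *\<^sub>R (\<Sum>i\<in>I. b i *\<^sub>R y i)"
  shows "p' \<bullet> p' = p \<bullet> p + 2 * \<tau> * (\<Sum>i\<in>I. b i * (x i \<bullet> y i))"
proof -
  let ?S = "\<Sum>i\<in>I. b i *\<^sub>R y i" and ?T = "\<Sum>i\<in>I. \<Sum>j\<in>I. b i * a i j * (y i \<bullet> y j)"
  have "?S \<bullet> ?S = (\<Sum>i\<in>I. \<Sum>j\<in>I. b i * b j * (y i \<bullet> y j))"
    by (simp add: inner_sum_left inner_sum_right sum_distrib_left inner_commute mult_ac)
  \<comment> \<open>The condition splits the coefficient b_i b_j into two terms that are transposes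
    of each other, so each gives the same double sum.\<close>
  also have "\<dots> = (\<Sum>i\<in>I. \<Sum>j\<in>I. b i * a i j * (y i \<bullet> y j) + b j * a j i * (y j \<bullet> y i))"
    by (intro sum.cong refl) (simp add: ab[symmetric] inner_commute distrib_right)
  also have "\<dots> = ?T + (\<Sum>i\<in>I. \<Sum>j\<in>I. b j * a j i * (y j \<bullet> y i))"
    by (simp add: sum.distrib)
  also have "(\<Sum>i\<in>I. \<Sum>j\<in>I. b j * a j i * (y j \<bullet> y i)) = ?T"
    by (rule sum.swap)
  finally have SS: "?S \<bullet> ?S = 2 * ?T"
    by simp
  have "(\<Sum>i\<in>I. b i * (x i \<bullet> y i)) = (\<Sum>i\<in>I. b i * (p \<bullet> y i) + \<tau> * (\<Sum>j\<in>I. b i * a i j * (y i \<bullet> y j)))"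
    by (intro sum.cong refl)
      (simp add: x inner_add_left inner_sum_left inner_sum_right inner_commute sum_distrib_left algebra_simps)
  also have "\<dots> = p \<bullet> ?S + \<tau> * ?T"
    by (simp add: sum.distrib inner_sum_right sum_distrib_left)
  finally have xy: "(\<Sum>i\<in>I. b i * (x i \<bullet> y i)) = p \<bullet> ?S + \<tau> * ?T" .
  have "p' \<bullet> p' = p \<bullet> p + 2 * \<tau> * (p \<bullet> ?S) + \<tau> * \<tau> * (?S \<bullet> ?S)"
    by (simp add: p' inner_add_left inner_add_right inner_commute algebra_simps)
  then show ?thesis
    unfolding SS xy by (simp add: algebra_simps)
qed

lemma has_sum_sum:
  fixes f :: "'i \<Rightarrow> 'k \<Rightarrow> 'v::topological_comm_monoid_add"
  assumes "\<And>i. i \<in> I \<Longrightarrow> (f i has_sum S i) A"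
  shows "((\<lambda>k. \<Sum>i\<in>I. f i k) has_sum (\<Sum>i\<in>I. S i)) A"
  using assms by (induction I rule: infinite_finite_induct) (auto intro: has_sum_add)

lemma inner_unimodular_mult:
  fixes u v w :: complex
  assumes "cmod u = 1"
  shows "(u * v) \<bullet> (u * w) = v \<bullet> w"
proof -
  have "u * cnj u = 1"
    using assms complex_norm_square[of u] by simp
  then have "(u * v) * cnj (u * w) = v * cnj w"
    by (metis complex_cnj_mult mult.assoc mult.commute mult.right_neutral)
  moreover have "z \<bullet> z' = Re (z * cnj z')" for z z' :: complex
    by (simp add: inner_complex_def)
  ultimately show ?thesis
    by (simp only:)
qed

section \<open>The nonlinear slopes and their pairings\<close>

context torus
begin

text \<open>The direction shared by both slopes: \<open>slope_psi\<close> is an imaginary multiple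
  of it, and \<open>slope_q\<close> pairs it with \<open>opL f\<close>. The energy balance depends
  on this sharing.\<close>

definition slope_dir :: "real \<Rightarrow> wave \<Rightarrow> wave" where
  "slope_dir C0 f = (\<lambda>z. (of_real (cmod (f z)))\<^sup>2 * f z / of_real (sav_root l1 l2 C0 f))"

text \<open>The modulus alone need not be differentiable at zeros of f, so its square is rewritten
  as f times its conjugate; the root is a constant in z.\<close>

lemma slope_dir_C2per:
  assumes "f \<in> C2per l1 l2"
  shows "slope_dir C0 f \<in> C2per l1 l2"
proof -
  have "slope_dir C0 f = (\<lambda>z. (1 / of_real (sav_root l1 l2 C0 f)) * ((f z * cnj (f z)) * f z))"
    unfolding slope_dir_def by (rule ext) (simp only: complex_norm_square[symmetric] of_real_power, simp)
  then show ?thesis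
    using assms by (simp only: C2per_mult C2per_const C2per_cnj)
qed

lemma slope_psi_eq:
  "slope_psi l1 l2 \<beta> C0 f q = (\<lambda>z. (- \<i> * of_real (\<beta> * q)) * slope_dir C0 f z)"
  by (simp add: slope_psi_def slope_dir_def fun_eq_iff)

lemma slope_psi_C2per: "f \<in> C2per l1 l2 \<Longrightarrow> slope_psi l1 l2 \<beta> C0 f q \<in> C2per l1 l2"
  unfolding slope_psi_eq by (intro C2per_mult C2per_const slope_dir_C2per)

lemma slope_q_eq: "slope_q l1 l2 C0 f = 2 * Re (- \<i> * inner2 (opL f) (slope_dir C0 f))"
  unfolding slope_q_def slope_dir_def[symmetric] ip_cmult_left ..

text \<open>The nonlinearity multiplies f pointwise by an imaginary number, hence the integrand is
  imaginary everywhere.\<close>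

lemma Re_ip_slope_psi: "Re (inner2 f (slope_psi l1 l2 \<beta> C0 f q)) = 0"
proof -
  let ?w = "\<lambda>z. \<beta> * q * (cmod (f z))^4 / sav_root l1 l2 C0 f"
  have "f z * cnj (slope_psi l1 l2 \<beta> C0 f q z) = \<i> * of_real (?w z)" for z
  proof -
    have "f z * cnj (slope_psi l1 l2 \<beta> C0 f q z)
        = \<i> * of_real (\<beta> * q / sav_root l1 l2 C0 f) * (of_real (cmod (f z)))\<^sup>2 * (f z * cnj (f z))"
      by (simp add: slope_psi_def)
    also have "f z * cnj (f z) = (of_real (cmod (f z)))\<^sup>2"
      using complex_norm_square[of "f z"] by simp
    finally show ?thesis
      by (simp add: power4_eq_xxxx power2_eq_square)
  qed
  then have "inner2 f (slope_psi l1 l2 \<beta> C0 f q) = \<i> * (LINT z:Omega l1 l2|lborel. of_real (?w z))"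
    unfolding ip_def set_integral_mult_right[symmetric] by (simp only:)
  also have "(LINT z:Omega l1 l2|lborel. complex_of_real (?w z)) = of_real (LINT z:Omega l1 l2|lborel. ?w z)"
    by (rule set_integral_complex_of_real)
  finally show ?thesis
    by simp
qed

text \<open>The right side is -\<beta>/2 times q times \<open>slope_q\<close>, unfolded as in
  \<open>slope_q_eq\<close>, ready to cancel the change of \<beta>/2 q^2 stage by stage.\<close>

lemma Re_ip_opL_slope_psi:
  "Re (inner2 (opL f) (slope_psi l1 l2 \<beta> C0 f q)) = - (\<beta> / 2) * (q * (2 * Re (- \<i> * inner2 (opL f) (slope_dir C0 f))))"
  unfolding slope_psi_eq ip_cmult_right by simp

lemma Parseval_inner:
  assumes "f \<in> C2per l1 l2" "bdd_meas g"
  shows "((\<lambda>k. V * (coef f k \<bullet> coef g k)) has_sum Re (inner2 f g)) UNIV"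
proof -
  have "Re (V * (coef f k * cnj (coef g k))) = V * (coef f k \<bullet> coef g k)" for k
    by (simp add: inner_complex_def)
  then show ?thesis
    using has_sum_Re[OF Parseval[OF assms]] by (simp only:)
qed

text \<open>\<open>opL f\<close> cannot take the regular place in \<open>Parseval\<close>, so the
  identity is used with g in that place and then conjugated.\<close>

lemma Parseval_opL:
  assumes f: "f \<in> C2per l1 l2" and g: "g \<in> C2per l1 l2"
  shows "((\<lambda>k. V * (of_real (ev k) * (coef f k * cnj (coef g k)))) has_sum inner2 (opL f) g) UNIV"
proof -
  have "((\<lambda>k. cnj (V * (coef g k * cnj (coef (opL f) k)))) has_sum cnj (inner2 g (opL f))) UNIV"
    unfolding has_sum_cnj_iff by (rule Parseval[OF g opL_C2per(1)[OF f]])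
  then show ?thesis
    by (simp add: ip_cnj[symmetric] opL_C2per(2)[OF f] mult_ac)
qed

lemma Parseval_opL_inner:
  assumes "f \<in> C2per l1 l2" "g \<in> C2per l1 l2"
  shows "((\<lambda>k. V * (ev k * (coef f k \<bullet> coef g k))) has_sum Re (inner2 (opL f) g)) UNIV"
proof -
  have "Re (V * (of_real (ev k) * (coef f k * cnj (coef g k)))) = V * (ev k * (coef f k \<bullet> coef g k))" for k
    by (simp add: inner_complex_def algebra_simps)
  then show ?thesis
    using has_sum_Re[OF Parseval_opL[OF assms]] by (simp only:)
qed

text \<open>Each Parseval term is an eigenvalue times a squared modulus. \<open>mod_energy\<close>
  is complex valued, whereas the step argument compares real parts.\<close>

lemma ip_opL_real:
  assumes "f \<in> C2per l1 l2"
  shows "inner2 (opL f) f = of_real (Re (inner2 (opL f) f))"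
proof -
  have "Im (V * (of_real (ev k) * (coef f k * cnj (coef f k)))) = 0" for k
    by (simp add: complex_mult_cnj)
  then have "((\<lambda>k :: int \<times> int. 0) has_sum Im (inner2 (opL f) f)) UNIV"
    using has_sum_Im[OF Parseval_opL[OF assms assms]] by (simp only:)
  then have "Im (inner2 (opL f) f) = 0"
    by (auto dest: infsumI)
  then show ?thesis
    by (simp add: complex_eq_iff)
qed

lemma erk_step_conserves:
  assumes ab: "\<And>i j. i \<in> {1..s} \<Longrightarrow> j \<in> {1..s} \<Longrightarrow> b i * a i j + b j * a j i = b i * b j"
    and step: "erk_step l1 l2 \<beta> C0 s a b \<tau> \<psi> q \<Psi> Q \<psi>' q'"
    and psi: "\<psi> \<in> C2per l1 l2" and psi': "\<psi>' \<in> C2per l1 l2"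
    and Psi: "\<And>i. i \<in> {1..s} \<Longrightarrow> \<Psi> i \<in> C2per l1 l2"
  shows "mass l1 l2 \<psi>' = mass l1 l2 \<psi>"
    and "mod_energy l1 l2 \<beta> C0 \<psi>' q' = mod_energy l1 l2 \<beta> C0 \<psi> q"
proof -
  define c where "c = rk_node s a"
  define K where "K = (\<lambda>i. slope_psi l1 l2 \<beta> C0 (\<Psi> i) (Q i))"
  define l where "l = (\<lambda>i. slope_q l1 l2 C0 (\<Psi> i))"
  have Psi_eq: "\<Psi> i = (\<lambda>z. exp_iL l1 l2 (- (c i * \<tau>)) \<psi> z
        + of_real \<tau> * (\<Sum>j=1..s. of_real (a i j) * exp_iL l1 l2 ((c j - c i) * \<tau>) (K j) z))"
    and Q_eq: "Q i = q + \<tau> * (\<Sum>j=1..s. a i j * l j)" if "i \<in> {1..s}" for i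
    using step that unfolding erk_step_def Let_def c_def K_def l_def by blast+
  have psi'_eq: "\<psi>' = (\<lambda>z. exp_iL l1 l2 (- \<tau>) \<psi> z
        + of_real \<tau> * (\<Sum>i=1..s. of_real (b i) * exp_iL l1 l2 (- ((1 - c i) * \<tau>)) (K i) z))"
    and q'_eq: "q' = q + \<tau> * (\<Sum>i=1..s. b i * l i)"
    using step unfolding erk_step_def Let_def c_def K_def l_def by blast+
  have K: "K i \<in> C2per l1 l2" if "i \<in> {1..s}" for i
    unfolding K_def by (intro slope_psi_C2per Psi that)

  \<comment> \<open>Weights \<open>w\<close> and times \<open>r\<close> are left free so that the
    stages and the final update are both instances.\<close>
  have coef_stage: "coef (\<lambda>z. exp_iL l1 l2 t \<psi> z
        + of_real \<tau> * (\<Sum>j=1..s. of_real (w j) * exp_iL l1 l2 (r j) (K j) z)) k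
      = exp (\<i> * of_real (ev k * t)) * coef \<psi> k
        + of_real \<tau> * (\<Sum>j=1..s. of_real (w j) * (exp (\<i> * of_real (ev k * r j)) * coef (K j) k))"
    for t w r k
  proof -
    have bm: "bdd_meas (\<lambda>z. of_real (w j) * exp_iL l1 l2 (r j) (K j) z)" if "j \<in> {1..s}" for j
      using K that by (intro bdd_meas_cmult exp_iL_C2per)
    have "coef (\<lambda>z. \<Sum>j=1..s. of_real (w j) * exp_iL l1 l2 (r j) (K j) z) k
        = (\<Sum>j=1..s. coef (\<lambda>z. of_real (w j) * exp_iL l1 l2 (r j) (K j) z) k)"
      by (rule coef_sum) (rule bm)
    also have "\<dots> = (\<Sum>j=1..s. of_real (w j) * (exp (\<i> * of_real (ev k * r j)) * coef (K j) k))"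
      by (intro sum.cong refl) (simp only: coef_cmult exp_iL_C2per(2)[OF K])
    finally have sum: "coef (\<lambda>z. \<Sum>j=1..s. of_real (w j) * exp_iL l1 l2 (r j) (K j) z) k
        = (\<Sum>j=1..s. of_real (w j) * (exp (\<i> * of_real (ev k * r j)) * coef (K j) k))" .
    have "bdd_meas (\<lambda>z. of_real \<tau> * (\<Sum>j=1..s. of_real (w j) * exp_iL l1 l2 (r j) (K j) z))"
      by (rule bdd_meas_cmult, rule bdd_meas_sum) (rule bm)
    then show ?thesis
      by (simp only: coef_add coef_cmult exp_iL_C2per[OF psi] sum)
  qed
  have rotate: "exp (\<i> * of_real (ev k * t)) * exp (\<i> * of_real (ev k * r)) = exp (\<i> * of_real (ev k * (t + r)))"
    for k t r
    by (simp add: exp_add[symmetric] algebra_simps)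

  have mode_identity: "coef \<psi>' k \<bullet> coef \<psi>' k
      = coef \<psi> k \<bullet> coef \<psi> k + 2 * \<tau> * (\<Sum>i=1..s. b i * (coef (\<Psi> i) k \<bullet> coef (K i) k))" for k
  proof -
    define R where "R = (\<lambda>t. exp (\<i> * of_real (ev k * t)))"
    have R: "R t * (R r * w) = R (t + r) * w" "R 0 = 1" "cmod (R t) = 1" for t r w
      using rotate[of k t r] by (simp_all add: R_def mult.assoc[symmetric])
    have pull: "R t * (of_real \<tau> * (\<Sum>j=1..s. of_real (w j) * (R (r j) * v j)))
        = \<tau> *\<^sub>R (\<Sum>j=1..s. w j *\<^sub>R (R (t + r j) * v j))" for t w r v
      unfolding R(1)[symmetric] by (simp add: sum_distrib_left scaleR_conv_of_real mult_ac)
    \<comment> \<open>After rotation by c_i \<tau> the j-th slope in stage i carries the time c_j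
      \<tau>, independently of i. The update rotated by \<tau> gives the same times, as \<tau> - (1
      - c_i) \<tau> = c_i \<tau>; so one family \<open>y\<close> serves all equations.\<close>
    define x where "x = (\<lambda>i. R (c i * \<tau>) * coef (\<Psi> i) k)"
    define y where "y = (\<lambda>i. R (c i * \<tau>) * coef (K i) k)"
    have x: "x i = coef \<psi> k + \<tau> *\<^sub>R (\<Sum>j=1..s. a i j *\<^sub>R y j)" if "i \<in> {1..s}" for i
    proof -
      have "coef (\<Psi> i) k = R (- (c i * \<tau>)) * coef \<psi> k
          + of_real \<tau> * (\<Sum>j=1..s. of_real (a i j) * (R ((c j - c i) * \<tau>) * coef (K j) k))"
        by (subst Psi_eq[OF that]) (simp only: coef_stage R_def)
      then show ?thesis
        by (simp add: x_def y_def distrib_left pull R(1,2) left_diff_distrib del: One_nat_def)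
    qed
    have "coef \<psi>' k = R (- \<tau>) * coef \<psi> k
        + of_real \<tau> * (\<Sum>i=1..s. of_real (b i) * (R (- ((1 - c i) * \<tau>)) * coef (K i) k))"
      by (subst psi'_eq) (simp only: coef_stage R_def)
    then have p': "R \<tau> * coef \<psi>' k = coef \<psi> k + \<tau> *\<^sub>R (\<Sum>i=1..s. b i *\<^sub>R y i)"
      by (simp add: y_def distrib_left pull R(1,2) left_diff_distrib del: One_nat_def)
    have "(R \<tau> * coef \<psi>' k) \<bullet> (R \<tau> * coef \<psi>' k)
        = coef \<psi> k \<bullet> coef \<psi> k + 2 * \<tau> * (\<Sum>i=1..s. b i * (x i \<bullet> y i))"
      by (rule RK_quadratic_identity[OF ab x p'])
    then show ?thesis
      by (simp add: x_def y_def inner_unimodular_mult R(3))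
  qed

  have "((\<lambda>k. V * (coef \<psi> k \<bullet> coef \<psi> k)
        + 2 * \<tau> * (\<Sum>i=1..s. b i * (V * (coef (\<Psi> i) k \<bullet> coef (K i) k)))) has_sum
      Re (inner2 \<psi> \<psi>) + 2 * \<tau> * (\<Sum>i=1..s. b i * Re (inner2 (\<Psi> i) (K i)))) UNIV"
    by (intro has_sum_add has_sum_cmult_right has_sum_sum Parseval_inner C2per_bdd_meas psi Psi K)
  then have "((\<lambda>k. V * (coef \<psi>' k \<bullet> coef \<psi>' k)) has_sum
      Re (inner2 \<psi> \<psi>) + 2 * \<tau> * (\<Sum>i=1..s. b i * Re (inner2 (\<Psi> i) (K i)))) UNIV"
    by (simp add: mode_identity distrib_left sum_distrib_left mult_ac)
  \<comment> \<open>The same series also sums to the mass of \<open>\<psi>'\<close> by Parseval, so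
    the two limits agree.\<close>
  from has_sum_unique[OF Parseval_inner[OF psi' C2per_bdd_meas[OF psi']] this]
  have "Re (inner2 \<psi>' \<psi>') = Re (inner2 \<psi> \<psi>)"
    by (simp add: K_def Re_ip_slope_psi)
  then show "mass l1 l2 \<psi>' = mass l1 l2 \<psi>"
    unfolding mass_def using ip_self_real by metis

  have "((\<lambda>k. V * (ev k * (coef \<psi> k \<bullet> coef \<psi> k))
        + 2 * \<tau> * (\<Sum>i=1..s. b i * (V * (ev k * (coef (\<Psi> i) k \<bullet> coef (K i) k))))) has_sum
      Re (inner2 (opL \<psi>) \<psi>) + 2 * \<tau> * (\<Sum>i=1..s. b i * Re (inner2 (opL (\<Psi> i)) (K i)))) UNIV"
    by (intro has_sum_add has_sum_cmult_right has_sum_sum Parseval_opL_inner psi Psi K)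
  then have "((\<lambda>k. V * (ev k * (coef \<psi>' k \<bullet> coef \<psi>' k))) has_sum
      Re (inner2 (opL \<psi>) \<psi>) + 2 * \<tau> * (\<Sum>i=1..s. b i * Re (inner2 (opL (\<Psi> i)) (K i)))) UNIV"
    by (simp add: mode_identity distrib_left sum_distrib_left mult_ac)
  from has_sum_unique[OF Parseval_opL_inner[OF psi' psi'] this]
  have "Re (inner2 (opL \<psi>') \<psi>') = Re (inner2 (opL \<psi>) \<psi>)
      + 2 * \<tau> * (\<Sum>i=1..s. b i * (- (\<beta> / 2) * (Q i * l i)))"
    by (simp only: K_def l_def slope_q_eq Re_ip_opL_slope_psi)
  also have "(\<Sum>i=1..s. b i * (- (\<beta> / 2) * (Q i * l i))) = - (\<beta> / 2) * (\<Sum>i=1..s. b i * (Q i \<bullet> l i))"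
    by (simp add: sum_distrib_left mult_ac)
  finally have kinetic: "Re (inner2 (opL \<psi>') \<psi>')
      = Re (inner2 (opL \<psi>) \<psi>) - \<beta> / 2 * (2 * \<tau> * (\<Sum>i=1..s. b i * (Q i \<bullet> l i)))"
    by simp
  \<comment> \<open>The auxiliary variable obeys the same Runge-Kutta equations with the real line
    as inner product space, which is why the products \<open>Q i \<bullet> l i\<close> were formed
    above.\<close>
  have "q' \<bullet> q' = q \<bullet> q + 2 * \<tau> * (\<Sum>i=1..s. b i * (Q i \<bullet> l i))"
    using Q_eq q'_eq by (intro RK_quadratic_identity[OF ab]) simp_all
  with kinetic have "Re (inner2 (opL \<psi>') \<psi>') + \<beta> / 2 * q'\<^sup>2 = Re (inner2 (opL \<psi>) \<psi>) + \<beta> / 2 * q\<^sup>2"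
    by (simp add: power2_eq_square algebra_simps)
  then have "inner2 (opL \<psi>') \<psi>' + of_real (\<beta> / 2 * q'\<^sup>2) = inner2 (opL \<psi>) \<psi> + of_real (\<beta> / 2 * q\<^sup>2)"
    using ip_opL_real[OF psi] ip_opL_real[OF psi'] by (metis of_real_add)
  then show "mod_energy l1 l2 \<beta> C0 \<psi>' q' = mod_energy l1 l2 \<beta> C0 \<psi> q"
    by (simp only: mod_energy_def)
qed

end

theorem theorem3p1:
  fixes l1 l2 \<beta> C0 T \<tau> :: real
    and N s :: nat
    and a :: "nat \<Rightarrow> nat \<Rightarrow> real" and b :: "nat \<Rightarrow> real"
    and \<psi>0 :: wave
    and \<psi> :: "nat \<Rightarrow> wave" and q :: "nat \<Rightarrow> real"
    and \<Psi> :: "nat \<Rightarrow> nat \<Rightarrow> wave" and Q :: "nat \<Rightarrow> nat \<Rightarrow> real"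
  assumes "l1 > 0" and "l2 > 0" and "C0 > 0" and "T > 0" and "N > 0"
    and "\<tau> = T / real N"
    and "\<And>n. n \<le> N \<Longrightarrow> \<psi> n \<in> C2per l1 l2"
    and "\<And>n i. n < N \<Longrightarrow> i \<in> {1..s} \<Longrightarrow> \<Psi> n i \<in> C2per l1 l2"
    and "\<psi> 0 = \<psi>0" and "q 0 = sav_root l1 l2 C0 \<psi>0"
    and "\<And>n. n < N \<Longrightarrow>
           erk_step l1 l2 \<beta> C0 s a b \<tau> (\<psi> n) (q n) (\<Psi> n) (Q n) (\<psi> (Suc n)) (q (Suc n))"
    and "\<And>i j. i \<in> {1..s} \<Longrightarrow> j \<in> {1..s} \<Longrightarrow> b i * a i j + b j * a j i = b i * b j"
  shows "\<forall>n\<in>{1..N}. mass l1 l2 (\<psi> n) = mass l1 l2 (\<psi> 0) \<and>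
           mod_energy l1 l2 \<beta> C0 (\<psi> n) (q n) = mod_energy l1 l2 \<beta> C0 (\<psi> 0) (q 0)"
proof -
  interpret torus l1 l2
    using assms(1,2) by unfold_locales
  have conserved: "mass l1 l2 (\<psi> n) = mass l1 l2 (\<psi> 0) \<and>
      mod_energy l1 l2 \<beta> C0 (\<psi> n) (q n) = mod_energy l1 l2 \<beta> C0 (\<psi> 0) (q 0)" if "n \<le> N" for n
    using that
  proof (induction n)
    case (Suc n)
    then have n: "n < N" "n \<le> N" "Suc n \<le> N"
      by simp_all
    note step = erk_step_conserves[OF assms(12) assms(11)[OF n(1)] assms(7)[OF n(2)]
        assms(7)[OF n(3)] assms(8)[OF n(1)]]
    show ?case
      using Suc.IH[OF n(2)] step by presburger
  qed simp
  show ?thesis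
  proof
    fix n
    assume "n \<in> {1..N}"
    then have "n \<le> N"
      by simp
    then show "mass l1 l2 (\<psi> n) = mass l1 l2 (\<psi> 0) \<and>
        mod_energy l1 l2 \<beta> C0 (\<psi> n) (q n) = mod_energy l1 l2 \<beta> C0 (\<psi> 0) (q 0)"
      by (rule conserved)
  qed
qed

end
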